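(* Let $A$ be a type in a context extended by a fresh bridge variable $\mathbf{x}$, let $B$ be a type family over $a:A$ in that context, and let $M_0:(\Sigma_{a:A}B)[\mathbf{0}/\mathbf{x}]$ and $M_1:(\Sigma_{a:A}B)[\mathbf{1}/\mathbf{x}]$. Then there is an equivalence \[ \mathsf{Bridge}_{\mathbf{x}.\Sigma_{a:A}B}(M_0,M_1)\simeq \Sigma_{p:\mathsf{Bridge}_{\mathbf{x}.A}(\mathsf{fst}\,M_0,\mathsf{fst}\,M_1)}\mathsf{Bridge}_{\mathbf{x}.B[p\,\mathbf{x}/a]}(\mathsf{snd}\,M_0,\mathsf{snd}\,M_1). \]
   Context: We work in parametric cubical type theory: Martin-Löf type theory with $\Sigma$-types, $\Pi$-types (with $\eta$) and a universe $\mathcal{U}$ of Kan types, extended by path dimensions (structural; variables $x,y,\dots$, constants $0,1$) with path types $\mathsf{Path}_{x.A}(M_0,M_1)$ and Kan operations, so that paths behave like identity types of homotopy type theory (equivalences $\simeq$ are defined as in homotopy type theory), and by bridge dimensions (substructural: weakening and exchange but no contraction; variables $\mathbf{x},\mathbf{y},\dots$, constants $\mathbf{0},\mathbf{1}$). For a type $A$ depending on a fresh bridge variable $\mathbf{x}$ and $M_{\boldsymbol\varepsilon}:A[\boldsymbol\varepsilon/\mathbf{x}]$, $\mathsf{Bridge}_{\mathbf{x}.A}(M_{\mathbf{0}},M_{\mathbf{1}})$ has elements $\lambda^{\mathbf{x}}P$ with $P[\boldsymbol\varepsilon/\mathbf{x}]=M_{\boldsymbol\varepsilon}$, application $Q\,\mathbf{r}$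 (only for $\mathbf{r}$ not occurring in $Q$), with $\beta$, endpoint rules $Q\,\boldsymbol\varepsilon=M_{\boldsymbol\varepsilon}$ and $\eta$. *)

theory Defs
  imports Main
begin

section \<open>Raw syntax\<close>

text \<open>
  Well-scoped terms are represented with de Bruijn indices. There is one index space for term
  variables, path variables and bridge variables alike; the context determines the sort of an
  index. \<open>Pth\<close> is the sort of path dimensions, \<open>Brg\<close> the sort of bridge dimensions, and
  \<open>Zero d\<close>, \<open>One d\<close> are the constants of sort \<open>d\<close>.

  \<open>Typ\<close> and \<open>Interval d\<close> are not types. They only occur on the right of a typing judgment:
  \<open>A \<Colon> Typ\<close> is the judgment that \<open>A\<close> is a type, \<open>r \<Colon> Interval d\<close> the judgment that \<open>r\<close> is a
  dimension term.

  Binders: the second argument of \<open>Pi\<close> and \<open>Sigma\<close>, the first argument of \<open>Path\<close>, \<open>Bridge\<close>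
  and \<open>Coe\<close>, the argument of \<open>Lam\<close>, \<open>PLam\<close>, \<open>BLam\<close>, and the last argument of \<open>Tube\<close>
  bind index 0. \<open>Coe A r s M\<close> is coercion of \<open>M\<close> along the path-indexed line of types \<open>A\<close> from
  \<open>r\<close> to \<open>s\<close>. \<open>Hcom A r s M Ts\<close> is homogeneous composition in \<open>A\<close> from \<open>r\<close> to \<open>s\<close> with cap
  \<open>M\<close>; a tube \<open>Tube d t u N\<close> has the face \<open>t = u\<close> (an equation of dimension terms of sort
  \<open>d\<close>) and the body \<open>N\<close>.

  \<open>Op c ts\<close> is an additional operator from a signature \<open>'c\<close>, left uninterpreted here; an argument
  \<open>Arg k t\<close> binds the indices below \<open>k\<close> in \<open>t\<close>. Operators serve to state additional rules
  (see \<open>derives\<close> below).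
\<close>

datatype dsort = Pth | Brg

datatype 'c exp =
    Var nat
  | Zero dsort | One dsort
  | Interval dsort
  | Typ
  | Univ
  | Pi "'c exp" "'c exp" | Lam "'c exp" | App "'c exp" "'c exp"
  | Sigma "'c exp" "'c exp" | Pair "'c exp" "'c exp" | Fst "'c exp" | Snd "'c exp"
  | Path "'c exp" "'c exp" "'c exp" | PLam "'c exp" | PApp "'c exp" "'c exp"
  | Bridge "'c exp" "'c exp" "'c exp" | BLam "'c exp" | BApp "'c exp" "'c exp"
  | Coe "'c exp" "'c exp" "'c exp" "'c exp"
  | Hcom "'c exp" "'c exp" "'c exp" "'c exp" "'c tube list"
  | Op 'c "'c arg list"
and 'c tube = Tube (tsort: dsort) (tlhs: "'c exp") (trhs: "'c exp") (tbody: "'c exp")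
and 'c arg = Arg nat "'c exp"

definition up_ren :: "(nat \<Rightarrow> nat) \<Rightarrow> nat \<Rightarrow> nat" where
  "up_ren \<rho> = case_nat 0 (\<lambda>i. Suc (\<rho> i))"

fun ren :: "(nat \<Rightarrow> nat) \<Rightarrow> 'c exp \<Rightarrow> 'c exp"
and ren_tube :: "(nat \<Rightarrow> nat) \<Rightarrow> 'c tube \<Rightarrow> 'c tube"
and ren_arg :: "(nat \<Rightarrow> nat) \<Rightarrow> 'c arg \<Rightarrow> 'c arg" where
  "ren \<rho> (Var i) = Var (\<rho> i)"
| "ren \<rho> (Zero d) = Zero d"
| "ren \<rho> (One d) = One d"
| "ren \<rho> (Interval d) = Interval d"
| "ren \<rho> Typ = Typ"
| "ren \<rho> Univ = Univ"
| "ren \<rho> (Pi A B) = Pi (ren \<rho> A) (ren (up_ren \<rho>) B)"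
| "ren \<rho> (Lam M) = Lam (ren (up_ren \<rho>) M)"
| "ren \<rho> (App M N) = App (ren \<rho> M) (ren \<rho> N)"
| "ren \<rho> (Sigma A B) = Sigma (ren \<rho> A) (ren (up_ren \<rho>) B)"
| "ren \<rho> (Pair M N) = Pair (ren \<rho> M) (ren \<rho> N)"
| "ren \<rho> (Fst M) = Fst (ren \<rho> M)"
| "ren \<rho> (Snd M) = Snd (ren \<rho> M)"
| "ren \<rho> (Path A M N) = Path (ren (up_ren \<rho>) A) (ren \<rho> M) (ren \<rho> N)"
| "ren \<rho> (PLam M) = PLam (ren (up_ren \<rho>) M)"
| "ren \<rho> (PApp M r) = PApp (ren \<rho> M) (ren \<rho> r)"
| "ren \<rho> (Bridge A M N) = Bridge (ren (up_ren \<rho>) A) (ren \<rho> M) (ren \<rho> N)"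
| "ren \<rho> (BLam M) = BLam (ren (up_ren \<rho>) M)"
| "ren \<rho> (BApp M r) = BApp (ren \<rho> M) (ren \<rho> r)"
| "ren \<rho> (Coe A r s M) = Coe (ren (up_ren \<rho>) A) (ren \<rho> r) (ren \<rho> s) (ren \<rho> M)"
| "ren \<rho> (Hcom A r s M Ts) =
     Hcom (ren \<rho> A) (ren \<rho> r) (ren \<rho> s) (ren \<rho> M) (map (ren_tube \<rho>) Ts)"
| "ren \<rho> (Op c ts) = Op c (map (ren_arg \<rho>) ts)"
| "ren_tube \<rho> (Tube d t u N) = Tube d (ren \<rho> t) (ren \<rho> u) (ren (up_ren \<rho>) N)"
| "ren_arg \<rho> (Arg k t) = Arg k (ren ((up_ren ^^ k) \<rho>) t)"

abbreviation wk :: "'c exp \<Rightarrow> 'c exp" where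
  "wk \<equiv> ren Suc"

definition up :: "(nat \<Rightarrow> 'c exp) \<Rightarrow> nat \<Rightarrow> 'c exp" where
  "up \<sigma> = case_nat (Var 0) (\<lambda>i. wk (\<sigma> i))"

fun sub :: "(nat \<Rightarrow> 'c exp) \<Rightarrow> 'c exp \<Rightarrow> 'c exp"
and sub_tube :: "(nat \<Rightarrow> 'c exp) \<Rightarrow> 'c tube \<Rightarrow> 'c tube"
and sub_arg :: "(nat \<Rightarrow> 'c exp) \<Rightarrow> 'c arg \<Rightarrow> 'c arg" where
  "sub \<sigma> (Var i) = \<sigma> i"
| "sub \<sigma> (Zero d) = Zero d"
| "sub \<sigma> (One d) = One d"
| "sub \<sigma> (Interval d) = Interval d"
| "sub \<sigma> Typ = Typ"
| "sub \<sigma> Univ = Univ"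
| "sub \<sigma> (Pi A B) = Pi (sub \<sigma> A) (sub (up \<sigma>) B)"
| "sub \<sigma> (Lam M) = Lam (sub (up \<sigma>) M)"
| "sub \<sigma> (App M N) = App (sub \<sigma> M) (sub \<sigma> N)"
| "sub \<sigma> (Sigma A B) = Sigma (sub \<sigma> A) (sub (up \<sigma>) B)"
| "sub \<sigma> (Pair M N) = Pair (sub \<sigma> M) (sub \<sigma> N)"
| "sub \<sigma> (Fst M) = Fst (sub \<sigma> M)"
| "sub \<sigma> (Snd M) = Snd (sub \<sigma> M)"
| "sub \<sigma> (Path A M N) = Path (sub (up \<sigma>) A) (sub \<sigma> M) (sub \<sigma> N)"
| "sub \<sigma> (PLam M) = PLam (sub (up \<sigma>) M)"
| "sub \<sigma> (PApp M r) = PApp (sub \<sigma> M) (sub \<sigma> r)"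
| "sub \<sigma> (Bridge A M N) = Bridge (sub (up \<sigma>) A) (sub \<sigma> M) (sub \<sigma> N)"
| "sub \<sigma> (BLam M) = BLam (sub (up \<sigma>) M)"
| "sub \<sigma> (BApp M r) = BApp (sub \<sigma> M) (sub \<sigma> r)"
| "sub \<sigma> (Coe A r s M) = Coe (sub (up \<sigma>) A) (sub \<sigma> r) (sub \<sigma> s) (sub \<sigma> M)"
| "sub \<sigma> (Hcom A r s M Ts) =
     Hcom (sub \<sigma> A) (sub \<sigma> r) (sub \<sigma> s) (sub \<sigma> M) (map (sub_tube \<sigma>) Ts)"
| "sub \<sigma> (Op c ts) = Op c (map (sub_arg \<sigma>) ts)"
| "sub_tube \<sigma> (Tube d t u N) = Tube d (sub \<sigma> t) (sub \<sigma> u) (sub (up \<sigma>) N)"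
| "sub_arg \<sigma> (Arg k t) = Arg k (sub ((up ^^ k) \<sigma>) t)"

definition inst :: "'c exp \<Rightarrow> 'c exp \<Rightarrow> 'c exp" where
  "inst M N = sub (case_nat N Var) M"

section \<open>Contexts\<close>

text \<open>
  A context is a list of slots, the most recent one first. Every slot takes up one de Bruijn
  index, including the two kinds that do not declare a variable: \<open>Cst d t u\<close> is the hypothesis
  that the dimension terms \<open>t\<close> and \<open>u\<close> of sort \<open>d\<close> are equal, and \<open>Dead\<close> marks a slot whose
  contents have been removed, so that removing a variable does not renumber the others.
\<close>

datatype 'c slot =
    Hyp "'c exp"
  | Dim dsort
  | Cst dsort "'c exp" "'c exp"
  | Dead

type_synonym 'c ctx = "'c slot list"

definition is_dim :: "dsort \<Rightarrow> 'c ctx \<Rightarrow> 'c exp \<Rightarrow> bool" where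
  "is_dim d \<Gamma> r \<longleftrightarrow>
     r = Zero d \<or> r = One d \<or> (\<exists>n < length \<Gamma>. r = Var n \<and> \<Gamma> ! n = Dim d)"

text \<open>
  Bridge equations have the form \<open>t = 0\<close> or \<open>t = 1\<close>; path equations are arbitrary.
\<close>

definition is_face :: "dsort \<Rightarrow> 'c ctx \<Rightarrow> 'c exp \<Rightarrow> 'c exp \<Rightarrow> bool" where
  "is_face d \<Gamma> t u \<longleftrightarrow>
     is_dim d \<Gamma> t \<and> is_dim d \<Gamma> u \<and> (d = Brg \<longrightarrow> u = Zero Brg \<or> u = One Brg)"

text \<open>
  \<open>restrict n \<Gamma>\<close> is the part of \<open>\<Gamma>\<close> that is apart from the bridge variable \<open>n\<close>: the variable
  itself, the equations mentioning it, and all \<^emph>\<open>term\<close> variables declared after it are removed,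
  since a term variable declared after a bridge variable may later be replaced by a term in which
  that bridge variable occurs. Dimension variables declared after \<open>n\<close> stay. In a context, ``the
  dimension \<open>r\<close> does not occur in \<open>Q\<close>'' is expressed by typing \<open>Q\<close> in \<open>apart r \<Gamma>\<close>; this is
  the form of the side condition that is stable under substitution, and it is what excludes
  contraction. Constants are apart from everything.
\<close>

fun restrict :: "nat \<Rightarrow> 'c ctx \<Rightarrow> 'c ctx" where
  "restrict n [] = []"
| "restrict 0 (_ # \<Gamma>) = Dead # \<Gamma>"
| "restrict (Suc n) (Hyp A # \<Gamma>) = Dead # restrict n \<Gamma>"
| "restrict (Suc n) (Dim d # \<Gamma>) = Dim d # restrict n \<Gamma>"
| "restrict (Suc n) (Cst d t u # \<Gamma>) =
     (if t = Var n \<or> u = Var n then Dead else Cst d t u) # restrict n \<Gamma>"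
| "restrict (Suc n) (Dead # \<Gamma>) = Dead # restrict n \<Gamma>"

definition apart :: "'c exp \<Rightarrow> 'c ctx \<Rightarrow> 'c ctx" where
  "apart r \<Gamma> = (case r of Var n \<Rightarrow> restrict n \<Gamma> | _ \<Rightarrow> \<Gamma>)"

section \<open>Judgments and rules\<close>

text \<open>
  Besides well-formed contexts, typing and judgmental equality there are auxiliary judgments for
  substitutions \<open>\<sigma>\<close> from \<open>\<Delta>\<close> to \<open>\<Gamma>\<close>, for componentwise equality of two such substitutions,
  and for well-formed composition problems \<open>Sys \<Gamma> A r M Ts\<close> (cap \<open>M\<close> at \<open>r\<close>, tubes \<open>Ts\<close>, all
  in \<open>A\<close>).
\<close>

datatype 'c jdg =
    Ctx "'c ctx"
  | Has "'c ctx" "'c exp" "'c exp"  ("(_ \<turnstile> _ \<Colon> _)" [51, 51, 51] 50)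
  | Eq "'c ctx" "'c exp" "'c exp" "'c exp"  ("(_ \<turnstile> _ \<doteq> _ \<Colon> _)" [51, 51, 51, 51] 50)
  | Sub "'c ctx" "nat \<Rightarrow> 'c exp" "'c ctx"
  | SubEq "'c ctx" "nat \<Rightarrow> 'c exp" "nat \<Rightarrow> 'c exp" "'c ctx"
  | Sys "'c ctx" "'c exp" "'c exp" "'c exp" "'c tube list"

text \<open>
  The rules below are those for the structure of contexts, \<open>\<Pi>\<close>, \<open>\<Sigma>\<close>, the universe, path types,
  bridge types and the Kan operations \<open>Coe\<close> and \<open>Hcom\<close> (available in every type) with their
  boundary equations. The parameter \<open>R\<close> is an arbitrary set of further typing and equality rules,
  each a pair of a set of premises and a conclusion: for instance, the equations
  computing the Kan operations at the individual type formers, univalence, Gel types, or further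
  data types. With \<open>R = {}\<close> one gets exactly the rules listed.

  Weakening, exchange and substitution are the rules for \<open>Sub\<close>. A bridge variable may only be
  replaced by a dimension \<open>r\<close> if everything substituted for the variables declared before it
  is apart from \<open>r\<close>, which is why there is no contraction for bridge variables.
  Congruence for operators that do not bind variables is an instance of \<open>eq_sub\<close>.
\<close>

inductive derives :: "('c jdg set \<times> 'c jdg) set \<Rightarrow> 'c jdg \<Rightarrow> bool"  (infix "\<tturnstile>" 45)
  for R :: "('c jdg set \<times> 'c jdg) set"
where
  \<comment> \<open>additional rules\<close>
  ext_has: "\<lbrakk>(Js, \<Gamma> \<turnstile> M \<Colon> A) \<in> R; R \<tturnstile> Ctx \<Gamma>; \<forall>J \<in> Js. R \<tturnstile> J\<rbrakk> \<Longrightarrow> R \<tturnstile> \<Gamma> \<turnstile> M \<Colon> A"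
| ext_eq: "\<lbrakk>(Js, \<Gamma> \<turnstile> M \<doteq> N \<Colon> A) \<in> R; R \<tturnstile> Ctx \<Gamma>; \<forall>J \<in> Js. R \<tturnstile> J\<rbrakk>
    \<Longrightarrow> R \<tturnstile> \<Gamma> \<turnstile> M \<doteq> N \<Colon> A"

  \<comment> \<open>contexts\<close>
| ctx_nil: "R \<tturnstile> Ctx []"
| ctx_hyp: "\<lbrakk>R \<tturnstile> Ctx \<Gamma>; R \<tturnstile> \<Gamma> \<turnstile> A \<Colon> Typ\<rbrakk> \<Longrightarrow> R \<tturnstile> Ctx (Hyp A # \<Gamma>)"
| ctx_dim: "R \<tturnstile> Ctx \<Gamma> \<Longrightarrow> R \<tturnstile> Ctx (Dim d # \<Gamma>)"
| ctx_cst: "\<lbrakk>R \<tturnstile> Ctx \<Gamma>; is_face d \<Gamma> t u\<rbrakk> \<Longrightarrow> R \<tturnstile> Ctx (Cst d t u # \<Gamma>)"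
| ctx_dead: "R \<tturnstile> Ctx \<Gamma> \<Longrightarrow> R \<tturnstile> Ctx (Dead # \<Gamma>)"

  \<comment> \<open>variables, dimensions, equational hypotheses\<close>
| var: "\<lbrakk>R \<tturnstile> Ctx \<Gamma>; n < length \<Gamma>; \<Gamma> ! n = Hyp A\<rbrakk>
    \<Longrightarrow> R \<tturnstile> \<Gamma> \<turnstile> Var n \<Colon> ren (\<lambda>i. i + Suc n) A"
| dim: "\<lbrakk>R \<tturnstile> Ctx \<Gamma>; is_dim d \<Gamma> r\<rbrakk> \<Longrightarrow> R \<tturnstile> \<Gamma> \<turnstile> r \<Colon> Interval d"
| cst: "\<lbrakk>R \<tturnstile> Ctx \<Gamma>; n < length \<Gamma>; \<Gamma> ! n = Cst d t u\<rbrakk>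
    \<Longrightarrow> R \<tturnstile> \<Gamma> \<turnstile> ren (\<lambda>i. i + Suc n) t \<doteq> ren (\<lambda>i. i + Suc n) u \<Colon> Interval d"
| absurd: "\<lbrakk>R \<tturnstile> \<Gamma> \<turnstile> Zero d \<doteq> One d \<Colon> Interval d; R \<tturnstile> \<Gamma> \<turnstile> M \<Colon> A; R \<tturnstile> \<Gamma> \<turnstile> N \<Colon> A\<rbrakk>
    \<Longrightarrow> R \<tturnstile> \<Gamma> \<turnstile> M \<doteq> N \<Colon> A"

  \<comment> \<open>substitutions\<close>
| sub_nil: "R \<tturnstile> Ctx \<Delta> \<Longrightarrow> R \<tturnstile> Sub \<Delta> \<sigma> []"
| sub_hyp: "\<lbrakk>R \<tturnstile> Sub \<Delta> (\<sigma> \<circ> Suc) \<Gamma>; R \<tturnstile> \<Gamma> \<turnstile> A \<Colon> Typ; R \<tturnstile> \<Delta> \<turnstile> \<sigma> 0 \<Colon> sub (\<sigma> \<circ> Suc) A\<rbrakk>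
    \<Longrightarrow> R \<tturnstile> Sub \<Delta> \<sigma> (Hyp A # \<Gamma>)"
| sub_path: "\<lbrakk>R \<tturnstile> Sub \<Delta> (\<sigma> \<circ> Suc) \<Gamma>; is_dim Pth \<Delta> (\<sigma> 0)\<rbrakk>
    \<Longrightarrow> R \<tturnstile> Sub \<Delta> \<sigma> (Dim Pth # \<Gamma>)"
| sub_bridge: "\<lbrakk>R \<tturnstile> Ctx \<Delta>; is_dim Brg \<Delta> (\<sigma> 0); R \<tturnstile> Sub (apart (\<sigma> 0) \<Delta>) (\<sigma> \<circ> Suc) \<Gamma>\<rbrakk>
    \<Longrightarrow> R \<tturnstile> Sub \<Delta> \<sigma> (Dim Brg # \<Gamma>)"
| sub_cst: "\<lbrakk>R \<tturnstile> Sub \<Delta> (\<sigma> \<circ> Suc) \<Gamma>; is_face d \<Gamma> t u;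
      R \<tturnstile> \<Delta> \<turnstile> sub (\<sigma> \<circ> Suc) t \<doteq> sub (\<sigma> \<circ> Suc) u \<Colon> Interval d\<rbrakk>
    \<Longrightarrow> R \<tturnstile> Sub \<Delta> \<sigma> (Cst d t u # \<Gamma>)"
| sub_dead: "R \<tturnstile> Sub \<Delta> (\<sigma> \<circ> Suc) \<Gamma> \<Longrightarrow> R \<tturnstile> Sub \<Delta> \<sigma> (Dead # \<Gamma>)"
| subeq_nil: "R \<tturnstile> SubEq \<Delta> \<sigma> \<tau> []"
| subeq_hyp: "\<lbrakk>R \<tturnstile> SubEq \<Delta> (\<sigma> \<circ> Suc) (\<tau> \<circ> Suc) \<Gamma>;
      R \<tturnstile> \<Delta> \<turnstile> \<sigma> 0 \<doteq> \<tau> 0 \<Colon> sub (\<sigma> \<circ> Suc) A\<rbrakk>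
    \<Longrightarrow> R \<tturnstile> SubEq \<Delta> \<sigma> \<tau> (Hyp A # \<Gamma>)"
| subeq_dim: "\<lbrakk>R \<tturnstile> SubEq \<Delta> (\<sigma> \<circ> Suc) (\<tau> \<circ> Suc) \<Gamma>; R \<tturnstile> \<Delta> \<turnstile> \<sigma> 0 \<doteq> \<tau> 0 \<Colon> Interval d\<rbrakk>
    \<Longrightarrow> R \<tturnstile> SubEq \<Delta> \<sigma> \<tau> (Dim d # \<Gamma>)"
| subeq_cst: "R \<tturnstile> SubEq \<Delta> (\<sigma> \<circ> Suc) (\<tau> \<circ> Suc) \<Gamma> \<Longrightarrow> R \<tturnstile> SubEq \<Delta> \<sigma> \<tau> (Cst d t u # \<Gamma>)"
| subeq_dead: "R \<tturnstile> SubEq \<Delta> (\<sigma> \<circ> Suc) (\<tau> \<circ> Suc) \<Gamma> \<Longrightarrow> R \<tturnstile> SubEq \<Delta> \<sigma> \<tau> (Dead # \<Gamma>)"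
| has_sub: "\<lbrakk>R \<tturnstile> Sub \<Delta> \<sigma> \<Gamma>; R \<tturnstile> \<Gamma> \<turnstile> M \<Colon> A\<rbrakk> \<Longrightarrow> R \<tturnstile> \<Delta> \<turnstile> sub \<sigma> M \<Colon> sub \<sigma> A"
| eq_sub: "\<lbrakk>R \<tturnstile> Sub \<Delta> \<sigma> \<Gamma>; R \<tturnstile> Sub \<Delta> \<tau> \<Gamma>; R \<tturnstile> SubEq \<Delta> \<sigma> \<tau> \<Gamma>; R \<tturnstile> \<Gamma> \<turnstile> M \<doteq> N \<Colon> A\<rbrakk>
    \<Longrightarrow> R \<tturnstile> \<Delta> \<turnstile> sub \<sigma> M \<doteq> sub \<tau> N \<Colon> sub \<sigma> A"

  \<comment> \<open>equality and conversion\<close>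
| eq_refl: "R \<tturnstile> \<Gamma> \<turnstile> M \<Colon> A \<Longrightarrow> R \<tturnstile> \<Gamma> \<turnstile> M \<doteq> M \<Colon> A"
| eq_sym: "R \<tturnstile> \<Gamma> \<turnstile> M \<doteq> N \<Colon> A \<Longrightarrow> R \<tturnstile> \<Gamma> \<turnstile> N \<doteq> M \<Colon> A"
| eq_trans: "\<lbrakk>R \<tturnstile> \<Gamma> \<turnstile> M \<doteq> N \<Colon> A; R \<tturnstile> \<Gamma> \<turnstile> N \<doteq> P \<Colon> A\<rbrakk> \<Longrightarrow> R \<tturnstile> \<Gamma> \<turnstile> M \<doteq> P \<Colon> A"
| has_conv: "\<lbrakk>R \<tturnstile> \<Gamma> \<turnstile> M \<Colon> A; R \<tturnstile> \<Gamma> \<turnstile> A \<doteq> B \<Colon> Typ\<rbrakk> \<Longrightarrow> R \<tturnstile> \<Gamma> \<turnstile> M \<Colon> B"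
| eq_conv: "\<lbrakk>R \<tturnstile> \<Gamma> \<turnstile> M \<doteq> N \<Colon> A; R \<tturnstile> \<Gamma> \<turnstile> A \<doteq> B \<Colon> Typ\<rbrakk> \<Longrightarrow> R \<tturnstile> \<Gamma> \<turnstile> M \<doteq> N \<Colon> B"

  \<comment> \<open>universe\<close>
| univ: "R \<tturnstile> Ctx \<Gamma> \<Longrightarrow> R \<tturnstile> \<Gamma> \<turnstile> Univ \<Colon> Typ"
| el: "R \<tturnstile> \<Gamma> \<turnstile> A \<Colon> Univ \<Longrightarrow> R \<tturnstile> \<Gamma> \<turnstile> A \<Colon> Typ"
| el_eq: "R \<tturnstile> \<Gamma> \<turnstile> A \<doteq> B \<Colon> Univ \<Longrightarrow> R \<tturnstile> \<Gamma> \<turnstile> A \<doteq> B \<Colon> Typ"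

  \<comment> \<open>dependent functions\<close>
| pi: "\<lbrakk>s \<in> {Univ, Typ}; R \<tturnstile> \<Gamma> \<turnstile> A \<Colon> s; R \<tturnstile> Hyp A # \<Gamma> \<turnstile> B \<Colon> s\<rbrakk> \<Longrightarrow> R \<tturnstile> \<Gamma> \<turnstile> Pi A B \<Colon> s"
| pi_eq: "\<lbrakk>s \<in> {Univ, Typ}; R \<tturnstile> \<Gamma> \<turnstile> A \<doteq> A' \<Colon> s; R \<tturnstile> Hyp A # \<Gamma> \<turnstile> B \<doteq> B' \<Colon> s\<rbrakk>
    \<Longrightarrow> R \<tturnstile> \<Gamma> \<turnstile> Pi A B \<doteq> Pi A' B' \<Colon> s"
| lam: "R \<tturnstile> Hyp A # \<Gamma> \<turnstile> M \<Colon> B \<Longrightarrow> R \<tturnstile> \<Gamma> \<turnstile> Lam M \<Colon> Pi A B"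
| lam_eq: "R \<tturnstile> Hyp A # \<Gamma> \<turnstile> M \<doteq> M' \<Colon> B \<Longrightarrow> R \<tturnstile> \<Gamma> \<turnstile> Lam M \<doteq> Lam M' \<Colon> Pi A B"
| app: "\<lbrakk>R \<tturnstile> \<Gamma> \<turnstile> M \<Colon> Pi A B; R \<tturnstile> \<Gamma> \<turnstile> N \<Colon> A\<rbrakk> \<Longrightarrow> R \<tturnstile> \<Gamma> \<turnstile> App M N \<Colon> inst B N"
| pi_beta: "\<lbrakk>R \<tturnstile> Hyp A # \<Gamma> \<turnstile> M \<Colon> B; R \<tturnstile> \<Gamma> \<turnstile> N \<Colon> A\<rbrakk>
    \<Longrightarrow> R \<tturnstile> \<Gamma> \<turnstile> App (Lam M) N \<doteq> inst M N \<Colon> inst B N"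
| pi_eta: "R \<tturnstile> \<Gamma> \<turnstile> M \<Colon> Pi A B \<Longrightarrow> R \<tturnstile> \<Gamma> \<turnstile> M \<doteq> Lam (App (wk M) (Var 0)) \<Colon> Pi A B"

  \<comment> \<open>dependent pairs\<close>
| sigma: "\<lbrakk>s \<in> {Univ, Typ}; R \<tturnstile> \<Gamma> \<turnstile> A \<Colon> s; R \<tturnstile> Hyp A # \<Gamma> \<turnstile> B \<Colon> s\<rbrakk>
    \<Longrightarrow> R \<tturnstile> \<Gamma> \<turnstile> Sigma A B \<Colon> s"
| sigma_eq: "\<lbrakk>s \<in> {Univ, Typ}; R \<tturnstile> \<Gamma> \<turnstile> A \<doteq> A' \<Colon> s; R \<tturnstile> Hyp A # \<Gamma> \<turnstile> B \<doteq> B' \<Colon> s\<rbrakk>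
    \<Longrightarrow> R \<tturnstile> \<Gamma> \<turnstile> Sigma A B \<doteq> Sigma A' B' \<Colon> s"
| pair: "\<lbrakk>R \<tturnstile> Hyp A # \<Gamma> \<turnstile> B \<Colon> Typ; R \<tturnstile> \<Gamma> \<turnstile> M \<Colon> A; R \<tturnstile> \<Gamma> \<turnstile> N \<Colon> inst B M\<rbrakk>
    \<Longrightarrow> R \<tturnstile> \<Gamma> \<turnstile> Pair M N \<Colon> Sigma A B"
| fst: "R \<tturnstile> \<Gamma> \<turnstile> M \<Colon> Sigma A B \<Longrightarrow> R \<tturnstile> \<Gamma> \<turnstile> Fst M \<Colon> A"
| snd: "R \<tturnstile> \<Gamma> \<turnstile> M \<Colon> Sigma A B \<Longrightarrow> R \<tturnstile> \<Gamma> \<turnstile> Snd M \<Colon> inst B (Fst M)"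
| sigma_beta_fst: "\<lbrakk>R \<tturnstile> Hyp A # \<Gamma> \<turnstile> B \<Colon> Typ; R \<tturnstile> \<Gamma> \<turnstile> M \<Colon> A; R \<tturnstile> \<Gamma> \<turnstile> N \<Colon> inst B M\<rbrakk>
    \<Longrightarrow> R \<tturnstile> \<Gamma> \<turnstile> Fst (Pair M N) \<doteq> M \<Colon> A"
| sigma_beta_snd: "\<lbrakk>R \<tturnstile> Hyp A # \<Gamma> \<turnstile> B \<Colon> Typ; R \<tturnstile> \<Gamma> \<turnstile> M \<Colon> A; R \<tturnstile> \<Gamma> \<turnstile> N \<Colon> inst B M\<rbrakk>
    \<Longrightarrow> R \<tturnstile> \<Gamma> \<turnstile> Snd (Pair M N) \<doteq> N \<Colon> inst B M"
| sigma_eta: "R \<tturnstile> \<Gamma> \<turnstile> M \<Colon> Sigma A B \<Longrightarrow> R \<tturnstile> \<Gamma> \<turnstile> M \<doteq> Pair (Fst M) (Snd M) \<Colon> Sigma A B"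

  \<comment> \<open>path types\<close>
| path: "\<lbrakk>s \<in> {Univ, Typ}; R \<tturnstile> Dim Pth # \<Gamma> \<turnstile> A \<Colon> s;
      R \<tturnstile> \<Gamma> \<turnstile> M0 \<Colon> inst A (Zero Pth); R \<tturnstile> \<Gamma> \<turnstile> M1 \<Colon> inst A (One Pth)\<rbrakk>
    \<Longrightarrow> R \<tturnstile> \<Gamma> \<turnstile> Path A M0 M1 \<Colon> s"
| path_eq: "\<lbrakk>s \<in> {Univ, Typ}; R \<tturnstile> Dim Pth # \<Gamma> \<turnstile> A \<doteq> A' \<Colon> s;
      R \<tturnstile> \<Gamma> \<turnstile> M0 \<doteq> M0' \<Colon> inst A (Zero Pth); R \<tturnstile> \<Gamma> \<turnstile> M1 \<doteq> M1' \<Colon> inst A (One Pth)\<rbrakk>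
    \<Longrightarrow> R \<tturnstile> \<Gamma> \<turnstile> Path A M0 M1 \<doteq> Path A' M0' M1' \<Colon> s"
| plam: "\<lbrakk>R \<tturnstile> Dim Pth # \<Gamma> \<turnstile> M \<Colon> A; R \<tturnstile> \<Gamma> \<turnstile> inst M (Zero Pth) \<doteq> M0 \<Colon> inst A (Zero Pth);
      R \<tturnstile> \<Gamma> \<turnstile> inst M (One Pth) \<doteq> M1 \<Colon> inst A (One Pth)\<rbrakk>
    \<Longrightarrow> R \<tturnstile> \<Gamma> \<turnstile> PLam M \<Colon> Path A M0 M1"
| plam_eq: "\<lbrakk>R \<tturnstile> \<Gamma> \<turnstile> PLam M \<Colon> Path A M0 M1; R \<tturnstile> Dim Pth # \<Gamma> \<turnstile> M \<doteq> M' \<Colon> A\<rbrakk>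
    \<Longrightarrow> R \<tturnstile> \<Gamma> \<turnstile> PLam M \<doteq> PLam M' \<Colon> Path A M0 M1"
| papp: "\<lbrakk>R \<tturnstile> \<Gamma> \<turnstile> Q \<Colon> Path A M0 M1; is_dim Pth \<Gamma> r\<rbrakk> \<Longrightarrow> R \<tturnstile> \<Gamma> \<turnstile> PApp Q r \<Colon> inst A r"
| path_beta: "\<lbrakk>R \<tturnstile> Dim Pth # \<Gamma> \<turnstile> M \<Colon> A; is_dim Pth \<Gamma> r\<rbrakk>
    \<Longrightarrow> R \<tturnstile> \<Gamma> \<turnstile> PApp (PLam M) r \<doteq> inst M r \<Colon> inst A r"
| path_zero: "R \<tturnstile> \<Gamma> \<turnstile> Q \<Colon> Path A M0 M1
    \<Longrightarrow> R \<tturnstile> \<Gamma> \<turnstile> PApp Q (Zero Pth) \<doteq> M0 \<Colon> inst A (Zero Pth)"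
| path_one: "R \<tturnstile> \<Gamma> \<turnstile> Q \<Colon> Path A M0 M1
    \<Longrightarrow> R \<tturnstile> \<Gamma> \<turnstile> PApp Q (One Pth) \<doteq> M1 \<Colon> inst A (One Pth)"
| path_eta: "R \<tturnstile> \<Gamma> \<turnstile> Q \<Colon> Path A M0 M1
    \<Longrightarrow> R \<tturnstile> \<Gamma> \<turnstile> Q \<doteq> PLam (PApp (wk Q) (Var 0)) \<Colon> Path A M0 M1"

  \<comment> \<open>bridge types\<close>
| bridge: "\<lbrakk>s \<in> {Univ, Typ}; R \<tturnstile> Dim Brg # \<Gamma> \<turnstile> A \<Colon> s;
      R \<tturnstile> \<Gamma> \<turnstile> M0 \<Colon> inst A (Zero Brg); R \<tturnstile> \<Gamma> \<turnstile> M1 \<Colon> inst A (One Brg)\<rbrakk>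
    \<Longrightarrow> R \<tturnstile> \<Gamma> \<turnstile> Bridge A M0 M1 \<Colon> s"
| bridge_eq: "\<lbrakk>s \<in> {Univ, Typ}; R \<tturnstile> Dim Brg # \<Gamma> \<turnstile> A \<doteq> A' \<Colon> s;
      R \<tturnstile> \<Gamma> \<turnstile> M0 \<doteq> M0' \<Colon> inst A (Zero Brg); R \<tturnstile> \<Gamma> \<turnstile> M1 \<doteq> M1' \<Colon> inst A (One Brg)\<rbrakk>
    \<Longrightarrow> R \<tturnstile> \<Gamma> \<turnstile> Bridge A M0 M1 \<doteq> Bridge A' M0' M1' \<Colon> s"
| blam: "\<lbrakk>R \<tturnstile> Dim Brg # \<Gamma> \<turnstile> M \<Colon> A; R \<tturnstile> \<Gamma> \<turnstile> inst M (Zero Brg) \<doteq> M0 \<Colon> inst A (Zero Brg);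
      R \<tturnstile> \<Gamma> \<turnstile> inst M (One Brg) \<doteq> M1 \<Colon> inst A (One Brg)\<rbrakk>
    \<Longrightarrow> R \<tturnstile> \<Gamma> \<turnstile> BLam M \<Colon> Bridge A M0 M1"
| blam_eq: "\<lbrakk>R \<tturnstile> \<Gamma> \<turnstile> BLam M \<Colon> Bridge A M0 M1; R \<tturnstile> Dim Brg # \<Gamma> \<turnstile> M \<doteq> M' \<Colon> A\<rbrakk>
    \<Longrightarrow> R \<tturnstile> \<Gamma> \<turnstile> BLam M \<doteq> BLam M' \<Colon> Bridge A M0 M1"
| bapp: "\<lbrakk>R \<tturnstile> Ctx \<Gamma>; is_dim Brg \<Gamma> r; R \<tturnstile> apart r \<Gamma> \<turnstile> Q \<Colon> Bridge A M0 M1\<rbrakk>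
    \<Longrightarrow> R \<tturnstile> \<Gamma> \<turnstile> BApp Q r \<Colon> inst A r"
| bridge_beta: "\<lbrakk>R \<tturnstile> Ctx \<Gamma>; is_dim Brg \<Gamma> r; R \<tturnstile> Dim Brg # apart r \<Gamma> \<turnstile> M \<Colon> A\<rbrakk>
    \<Longrightarrow> R \<tturnstile> \<Gamma> \<turnstile> BApp (BLam M) r \<doteq> inst M r \<Colon> inst A r"
| bridge_zero: "R \<tturnstile> \<Gamma> \<turnstile> Q \<Colon> Bridge A M0 M1
    \<Longrightarrow> R \<tturnstile> \<Gamma> \<turnstile> BApp Q (Zero Brg) \<doteq> M0 \<Colon> inst A (Zero Brg)"
| bridge_one: "R \<tturnstile> \<Gamma> \<turnstile> Q \<Colon> Bridge A M0 M1
    \<Longrightarrow> R \<tturnstile> \<Gamma> \<turnstile> BApp Q (One Brg) \<doteq> M1 \<Colon> inst A (One Brg)"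
| bridge_eta: "R \<tturnstile> \<Gamma> \<turnstile> Q \<Colon> Bridge A M0 M1
    \<Longrightarrow> R \<tturnstile> \<Gamma> \<turnstile> Q \<doteq> BLam (BApp (wk Q) (Var 0)) \<Colon> Bridge A M0 M1"

  \<comment> \<open>coercion\<close>
| coe: "\<lbrakk>R \<tturnstile> Dim Pth # \<Gamma> \<turnstile> A \<Colon> Typ; is_dim Pth \<Gamma> r; is_dim Pth \<Gamma> s; R \<tturnstile> \<Gamma> \<turnstile> M \<Colon> inst A r\<rbrakk>
    \<Longrightarrow> R \<tturnstile> \<Gamma> \<turnstile> Coe A r s M \<Colon> inst A s"
| coe_eq: "\<lbrakk>R \<tturnstile> Dim Pth # \<Gamma> \<turnstile> A \<doteq> A' \<Colon> Typ;
      is_dim Pth \<Gamma> r; is_dim Pth \<Gamma> r'; R \<tturnstile> \<Gamma> \<turnstile> r \<doteq> r' \<Colon> Interval Pth;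
      is_dim Pth \<Gamma> s; is_dim Pth \<Gamma> s'; R \<tturnstile> \<Gamma> \<turnstile> s \<doteq> s' \<Colon> Interval Pth;
      R \<tturnstile> \<Gamma> \<turnstile> M \<doteq> M' \<Colon> inst A r\<rbrakk>
    \<Longrightarrow> R \<tturnstile> \<Gamma> \<turnstile> Coe A r s M \<doteq> Coe A' r' s' M' \<Colon> inst A s"
| coe_cap: "\<lbrakk>R \<tturnstile> Dim Pth # \<Gamma> \<turnstile> A \<Colon> Typ; is_dim Pth \<Gamma> r; R \<tturnstile> \<Gamma> \<turnstile> M \<Colon> inst A r\<rbrakk>
    \<Longrightarrow> R \<tturnstile> \<Gamma> \<turnstile> Coe A r r M \<doteq> M \<Colon> inst A r"

  \<comment> \<open>composition: in a system, every tube lives over its face, agrees with the cap at \<open>r\<close>, and any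
     two tubes agree where their faces meet\<close>
| sys: "\<lbrakk>R \<tturnstile> \<Gamma> \<turnstile> A \<Colon> Typ; is_dim Pth \<Gamma> r; R \<tturnstile> \<Gamma> \<turnstile> M \<Colon> A;
      \<forall>T \<in> set Ts. is_face (tsort T) \<Gamma> (tlhs T) (trhs T);
      \<forall>T \<in> set Ts. R \<tturnstile> Cst (tsort T) (wk (tlhs T)) (wk (trhs T)) # Dim Pth # \<Gamma>
        \<turnstile> wk (tbody T) \<Colon> wk (wk A);
      \<forall>T \<in> set Ts. R \<tturnstile> Cst (tsort T) (tlhs T) (trhs T) # \<Gamma>
        \<turnstile> wk (inst (tbody T) r) \<doteq> wk M \<Colon> wk A;
      \<forall>T \<in> set Ts. \<forall>U \<in> set Ts.
        R \<tturnstile> Cst (tsort U) (wk (wk (tlhs U))) (wk (wk (trhs U))) #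
            Cst (tsort T) (wk (tlhs T)) (wk (trhs T)) # Dim Pth # \<Gamma>
          \<turnstile> wk (wk (tbody T)) \<doteq> wk (wk (tbody U)) \<Colon> wk (wk (wk A))\<rbrakk>
    \<Longrightarrow> R \<tturnstile> Sys \<Gamma> A r M Ts"
| hcom: "\<lbrakk>R \<tturnstile> Sys \<Gamma> A r M Ts; is_dim Pth \<Gamma> s\<rbrakk> \<Longrightarrow> R \<tturnstile> \<Gamma> \<turnstile> Hcom A r s M Ts \<Colon> A"
| hcom_eq: "\<lbrakk>R \<tturnstile> Sys \<Gamma> A r M Ts; R \<tturnstile> Sys \<Gamma> A' r' M' Ts'; R \<tturnstile> \<Gamma> \<turnstile> A \<doteq> A' \<Colon> Typ;
      R \<tturnstile> \<Gamma> \<turnstile> r \<doteq> r' \<Colon> Interval Pth;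
      is_dim Pth \<Gamma> s; is_dim Pth \<Gamma> s'; R \<tturnstile> \<Gamma> \<turnstile> s \<doteq> s' \<Colon> Interval Pth;
      R \<tturnstile> \<Gamma> \<turnstile> M \<doteq> M' \<Colon> A; length Ts = length Ts';
      \<forall>i < length Ts. tsort (Ts ! i) = tsort (Ts' ! i);
      \<forall>i < length Ts. R \<tturnstile> \<Gamma> \<turnstile> tlhs (Ts ! i) \<doteq> tlhs (Ts' ! i) \<Colon> Interval (tsort (Ts ! i));
      \<forall>i < length Ts. R \<tturnstile> \<Gamma> \<turnstile> trhs (Ts ! i) \<doteq> trhs (Ts' ! i) \<Colon> Interval (tsort (Ts ! i));
      \<forall>i < length Ts.
        R \<tturnstile> Cst (tsort (Ts ! i)) (wk (tlhs (Ts ! i))) (wk (trhs (Ts ! i))) # Dim Pth # \<Gamma>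
          \<turnstile> wk (tbody (Ts ! i)) \<doteq> wk (tbody (Ts' ! i)) \<Colon> wk (wk A)\<rbrakk>
    \<Longrightarrow> R \<tturnstile> \<Gamma> \<turnstile> Hcom A r s M Ts \<doteq> Hcom A' r' s' M' Ts' \<Colon> A"
| hcom_cap: "R \<tturnstile> Sys \<Gamma> A r M Ts \<Longrightarrow> R \<tturnstile> \<Gamma> \<turnstile> Hcom A r r M Ts \<doteq> M \<Colon> A"
| hcom_tube: "\<lbrakk>R \<tturnstile> Sys \<Gamma> A r M Ts; is_dim Pth \<Gamma> s; Tube d t u N \<in> set Ts;
      R \<tturnstile> \<Gamma> \<turnstile> t \<doteq> u \<Colon> Interval d\<rbrakk>
    \<Longrightarrow> R \<tturnstile> \<Gamma> \<turnstile> Hcom A r s M Ts \<doteq> inst N s \<Colon> A"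

section \<open>Equivalences\<close>

text \<open>
  A map is an equivalence if all its homotopy fibres are contractible, with \<open>Path\<close> in the role of
  the identity type.
\<close>

definition Arr :: "'c exp \<Rightarrow> 'c exp \<Rightarrow> 'c exp" where
  "Arr A B = Pi A (wk B)"

definition Id :: "'c exp \<Rightarrow> 'c exp \<Rightarrow> 'c exp \<Rightarrow> 'c exp" where
  "Id A M N = Path (wk A) M N"

definition IsContr :: "'c exp \<Rightarrow> 'c exp" where
  "IsContr A = Sigma A (Pi (wk A) (Id (wk (wk A)) (Var 1) (Var 0)))"

definition Fiber :: "'c exp \<Rightarrow> 'c exp \<Rightarrow> 'c exp \<Rightarrow> 'c exp \<Rightarrow> 'c exp" where
  "Fiber A B F b = Sigma A (Id (wk B) (App (wk F) (Var 0)) (wk b))"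

definition IsEquiv :: "'c exp \<Rightarrow> 'c exp \<Rightarrow> 'c exp \<Rightarrow> 'c exp" where
  "IsEquiv A B F = Pi B (IsContr (Fiber (wk A) (wk B) (wk F) (Var 0)))"

definition Equiv :: "'c exp \<Rightarrow> 'c exp \<Rightarrow> 'c exp" where
  "Equiv A B = Sigma (Arr A B) (IsEquiv (wk A) (wk B) (Var 0))"

end

theory Submission
  imports Defs
begin

text \<open>
  The maps \<open>q \<mapsto> (\<lambda>x. fst (q x), \<lambda>x. snd (q x))\<close> and \<open>w \<mapsto> \<lambda>x. (fst w x, snd w x)\<close> are inverse to each
  other up to judgmental equality, by \<open>\<beta>\<close> and \<open>\<eta>\<close> for pairs and bridges; only the types of second
  components have to be transported along such equations. A judgmental isomorphism \<open>(F, G)\<close> from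
  \<open>A\<close> to \<open>B\<close> is an equivalence: since there are no connections or reversals, the contraction of
  the fibre over \<open>b\<close> onto \<open>(G b, refl)\<close> is built from a single composition. For a path \<open>p\<close> from
  \<open>F a\<close> to \<open>b\<close> let \<open>h r s\<close> be the composite from \<open>1\<close> to \<open>s\<close> of \<open>b\<close> with tubes \<open>b\<close> on \<open>r = 0\<close> and \<open>p\<close>
  on \<open>r = 1\<close>; then \<open>r \<mapsto> (G (h r 0), \<lambda>s. h r s)\<close> leads from \<open>(G b, refl)\<close> to \<open>(a, p)\<close>.
\<close>

section \<open>Substitution calculus\<close>

text \<open>Since \<open>R\<close> is arbitrary, an equation need not have typed sides and a typing
  need not have a well-formed type. Presuppositions therefore cannot be recovered from a derivation
  and are carried along as hypotheses. Two further points shape the work. Congruence for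
  \<open>Fst\<close>, \<open>Snd\<close>, \<open>Pair\<close>, \<open>App\<close> and
  \<open>BApp\<close> is only available through \<open>eq_sub\<close>, as an equation between two
  substitution instances of a generic term, so explicit substitutions have to be built first; at a
  bridge variable they must be built over the context apart from it, which is where the lack of
  contraction is felt. And the constructions take place under binders, for a variable point of a
  fibre or a fresh path dimension. To handle this, all assumptions are kept in locales that are
  stable under context extension, and a result about terms over the longer context is used at its
  newest variable.\<close>

lemma up_Var: "up Var = Var"
  by (rule ext) (simp add: up_def split: nat.split)

lemma up_pow_Var: "(up ^^ k) Var = Var"
  by (induction k) (simp_all add: up_Var)

lemma sub_Var [simp]: "sub Var M = (M :: 'c exp)"
  and "sub_tube Var T = (T :: 'c tube)"
  and "sub_arg Var t = (t :: 'c arg)"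
  by (induction M and T and t) (simp_all add: up_Var up_pow_Var map_idI)

lemma up_comp_up_ren: "up \<sigma> \<circ> up_ren \<rho> = up (\<sigma> \<circ> \<rho>)"
  by (rule ext) (simp add: up_def up_ren_def split: nat.split)

text \<open>\<open>Arg k t\<close> binds \<open>k\<close> indices at once, so the induction over
  terms meets iterated liftings.\<close>

lemma up_pow_comp_up_ren: "(up ^^ k) \<sigma> \<circ> (up_ren ^^ k) \<rho> = (up ^^ k) (\<sigma> \<circ> \<rho>)"
proof (induction k)
  case (Suc k)
  have "(up ^^ Suc k) \<sigma> \<circ> (up_ren ^^ Suc k) \<rho> = up ((up ^^ k) \<sigma> \<circ> (up_ren ^^ k) \<rho>)"
    by (simp add: up_comp_up_ren)
  then show ?case by (simp only: Suc) simp
qed simp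

text \<open>The composition laws build on one another: \<open>up\<close> weakens, hence renames, so
  composing two substitutions under a binder needs the two mixed laws for a substitution and a
  renaming first.\<close>

lemma sub_ren: "sub \<sigma> (ren \<rho> M) = sub (\<sigma> \<circ> \<rho>) (M :: 'c exp)"
  and "sub_tube \<sigma> (ren_tube \<rho> T) = sub_tube (\<sigma> \<circ> \<rho>) (T :: 'c tube)"
  and "sub_arg \<sigma> (ren_arg \<rho> t) = sub_arg (\<sigma> \<circ> \<rho>) (t :: 'c arg)"
  by (induction M and T and t arbitrary: \<sigma> \<rho> and \<sigma> \<rho> and \<sigma> \<rho>)
    (simp_all add: up_comp_up_ren up_pow_comp_up_ren)

text \<open>The case \<open>\<sigma> = Var\<close> of \<open>sub_ren\<close>. Seeing renamings as
  substitutions spares a separate composition law for two renamings.\<close>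

lemma ren_conv_sub: "ren \<rho> M = sub (\<lambda>i. Var (\<rho> i)) M"
  using sub_ren[of Var \<rho> M] by (simp add: comp_def)

lemma ren_up: "ren (up_ren \<rho>) (up \<sigma> i) = up (ren \<rho> \<circ> \<sigma>) i"
  by (simp add: up_def up_ren_def ren_conv_sub sub_ren[unfolded ren_conv_sub] comp_def split: nat.split)

lemma ren_up_pow: "ren ((up_ren ^^ k) \<rho>) \<circ> (up ^^ k) \<sigma> = (up ^^ k) (ren \<rho> \<circ> \<sigma>)"
proof (induction k)
  case (Suc k)
  have "ren ((up_ren ^^ Suc k) \<rho>) \<circ> (up ^^ Suc k) \<sigma> = up (ren ((up_ren ^^ k) \<rho>) \<circ> (up ^^ k) \<sigma>)"
    by (rule ext) (simp add: ren_up)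
  then show ?case by (simp add: Suc)
qed simp

lemma ren_sub: "ren \<rho> (sub \<sigma> M) = sub (ren \<rho> \<circ> \<sigma>) (M :: 'c exp)"
  and "ren_tube \<rho> (sub_tube \<sigma> T) = sub_tube (ren \<rho> \<circ> \<sigma>) (T :: 'c tube)"
  and "ren_arg \<rho> (sub_arg \<sigma> t) = sub_arg (ren \<rho> \<circ> \<sigma>) (t :: 'c arg)"
proof (induction M and T and t arbitrary: \<sigma> \<rho> and \<sigma> \<rho> and \<sigma> \<rho>)
qed (simp_all add: ren_up_pow ren_up_pow[where k = 1, simplified])

lemma sub_up: "sub (up \<tau>) (up \<sigma> i) = up (sub \<tau> \<circ> \<sigma>) i"
  by (simp add: up_def sub_ren ren_sub comp_def split: nat.split)

lemma sub_up_pow: "sub ((up ^^ k) \<tau>) \<circ> (up ^^ k) \<sigma> = (up ^^ k) (sub \<tau> \<circ> \<sigma>)"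
proof (induction k)
  case (Suc k)
  have "sub ((up ^^ Suc k) \<tau>) \<circ> (up ^^ Suc k) \<sigma> = up (sub ((up ^^ k) \<tau>) \<circ> (up ^^ k) \<sigma>)"
    by (rule ext) (simp add: sub_up)
  then show ?case by (simp add: Suc)
qed simp

lemma sub_sub_comp: "sub \<tau> (sub \<sigma> M) = sub (sub \<tau> \<circ> \<sigma>) (M :: 'c exp)"
  and "sub_tube \<tau> (sub_tube \<sigma> T) = sub_tube (sub \<tau> \<circ> \<sigma>) (T :: 'c tube)"
  and "sub_arg \<tau> (sub_arg \<sigma> t) = sub_arg (sub \<tau> \<circ> \<sigma>) (t :: 'c arg)"
  by (induction M and T and t arbitrary: \<sigma> \<tau> and \<sigma> \<tau> and \<sigma> \<tau>)
    (simp_all add: sub_up_pow sub_up_pow[where k = 1, simplified])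

lemma sub_sub: "sub \<tau> (sub \<sigma> M) = sub (\<lambda>i. sub \<tau> (\<sigma> i)) M"
  by (simp add: sub_sub_comp comp_def)

lemma sub_cong: "(\<And>i. \<sigma> i = \<tau> i) \<Longrightarrow> sub \<sigma> M = sub \<tau> M"
  by (metis ext)

lemma sub_id: "(\<And>i. \<sigma> i = Var i) \<Longrightarrow> sub \<sigma> M = M"
  by (metis ext sub_Var)

lemma up_conv: "up \<sigma> = case_nat (Var 0) (\<lambda>i. sub (\<lambda>i. Var (Suc i)) (\<sigma> i))"
  by (simp add: up_def ren_conv_sub)

text \<open>These collapse any nest of renamings, liftings and instantiations into one
  \<open>sub\<close>, so that an equation between such terms becomes, by \<open>sub_cong\<close> or
  \<open>sub_id\<close>, a case distinction on the index.\<close>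

lemmas subst_simps = inst_def ren_conv_sub up_conv up_ren_def sub_sub Let_def comp_def

lemma inst_wk [simp]: "inst (wk M) N = M"
  by (simp add: inst_def sub_ren comp_def)

section \<open>Weakening and lifting of substitutions\<close>

lemma restrict_nth:
  "n < length \<Gamma> \<Longrightarrow> n \<noteq> k \<Longrightarrow> \<Gamma> ! n = Dim d \<Longrightarrow> restrict k \<Gamma> ! n = Dim d"
  by (induction k \<Gamma> arbitrary: n rule: restrict.induct) (auto simp: nth_Cons split: nat.splits)

lemma length_restrict [simp]: "length (restrict k \<Gamma>) = length \<Gamma>"
  by (induction k \<Gamma> rule: restrict.induct) auto

text \<open>Slots older than \<open>k\<close> cannot mention it and survive unchanged. This is what
  allows a bridge variable to be replaced by itself in \<open>Sub_drop\<close>.\<close>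

lemma drop_restrict: "drop (Suc k) (restrict k \<Gamma>) = drop (Suc k) \<Gamma>"
  by (induction k \<Gamma> rule: restrict.induct) auto

lemma is_dim_restrict: "is_dim d \<Gamma> r \<Longrightarrow> r \<noteq> Var k \<Longrightarrow> is_dim d (restrict k \<Gamma>) r"
  by (auto simp: is_dim_def restrict_nth)

text \<open>Inversion is informative for \<open>Ctx\<close> and \<open>Sub\<close> because
  \<open>R\<close> contributes conclusions of the forms \<open>Has\<close> and \<open>Eq\<close>
  only.\<close>

inductive_cases Ctx_ConsE: "R \<tturnstile> Ctx (s # \<Gamma>)"
inductive_cases Ctx_HypE: "R \<tturnstile> Ctx (Hyp A # \<Gamma>)"
inductive_cases Ctx_CstE: "R \<tturnstile> Ctx (Cst d t u # \<Gamma>)"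
inductive_cases Sub_HypE: "R \<tturnstile> Sub \<Delta> \<sigma> (Hyp A # \<Gamma>)"
inductive_cases Sub_DimE: "R \<tturnstile> Sub \<Delta> \<sigma> (Dim d # \<Gamma>)"
inductive_cases Sub_CstE: "R \<tturnstile> Sub \<Delta> \<sigma> (Cst d t u # \<Gamma>)"
inductive_cases Sub_DeadE: "R \<tturnstile> Sub \<Delta> \<sigma> (Dead # \<Gamma>)"

lemma Ctx_tl: "R \<tturnstile> Ctx (s # \<Gamma>) \<Longrightarrow> R \<tturnstile> Ctx \<Gamma>"
  by (erule Ctx_ConsE)

lemma Ctx_drop: "R \<tturnstile> Ctx \<Gamma> \<Longrightarrow> R \<tturnstile> Ctx (drop n \<Gamma>)"
proof (induction \<Gamma> arbitrary: n)
  case (Cons s \<Gamma>)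
  then show ?case by (cases n) (auto dest: Ctx_tl)
qed simp

text \<open>Term variables newer than the removed one become \<open>Dead\<close>, so no type has to
  be checked again. Only a surviving equation needs an argument: it does not mention the removed
  variable, hence is still a face.\<close>

lemma Ctx_restrict: "R \<tturnstile> Ctx \<Gamma> \<Longrightarrow> R \<tturnstile> Ctx (restrict k \<Gamma>)"
proof (induction \<Gamma> arbitrary: k)
  case (Cons s \<Gamma>)
  from Cons.prems have "R \<tturnstile> Ctx \<Gamma>" by (rule Ctx_tl)
  then have IH: "R \<tturnstile> Ctx (restrict n \<Gamma>)" for n by (rule Cons.IH)
  show ?case
  proof (cases k)
    case 0
    then show ?thesis using \<open>R \<tturnstile> Ctx \<Gamma>\<close> by (simp add: ctx_dead)
  next
    case (Suc n)
    show ?thesis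
    proof (cases s)
      case (Cst d t u)
      then have "is_face d \<Gamma> t u" using Cons.prems by (auto elim: Ctx_CstE)
      then have "is_face d (restrict n \<Gamma>) t u" if "t \<noteq> Var n" "u \<noteq> Var n"
        using that by (simp add: is_face_def is_dim_restrict)
      then show ?thesis using Suc Cst IH by (simp add: ctx_dead ctx_cst)
    qed (use Suc IH in \<open>simp_all add: ctx_dead ctx_dim\<close>)
  qed
qed (simp add: ctx_nil)

text \<open>Identity and weakening are the cases \<open>k = 0\<close> and \<open>k = 1\<close> of
  one statement, whose induction over \<open>\<Gamma>\<close> moves \<open>k\<close> along.\<close>

lemma Sub_drop: "R \<tturnstile> Ctx \<Delta> \<Longrightarrow> drop k \<Delta> = \<Gamma> \<Longrightarrow> R \<tturnstile> Sub \<Delta> (\<lambda>i. Var (i + k)) \<Gamma>"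
proof (induction \<Gamma> arbitrary: \<Delta> k)
  case Nil
  then show ?case by (simp add: sub_nil)
next
  case (Cons s \<Gamma>)
  have k: "k < length \<Delta>"
    using Cons.prems by (metis drop_eq_Nil2 linorder_not_le list.distinct(1))
  have s: "\<Delta> ! k = s" and tl: "drop (Suc k) \<Delta> = \<Gamma>"
    using Cons.prems by (auto simp: nth_via_drop drop_Suc simp flip: tl_drop)
  have IH: "R \<tturnstile> Sub \<Delta> ((\<lambda>i. Var (i + k)) \<circ> Suc) \<Gamma>"
    using Cons.IH[of \<Delta> "Suc k"] Cons.prems(1) k tl by (simp add: comp_def)
  have ctx: "R \<tturnstile> Ctx (drop n \<Delta>)" for n
    using Cons.prems(1) by (rule Ctx_drop)
  show ?case
  proof (cases s)
    case (Hyp A)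
    have "R \<tturnstile> \<Gamma> \<turnstile> A \<Colon> Typ"
      using ctx[of k] Cons.prems(2) Hyp by (auto elim: Ctx_HypE)
    with Hyp show ?thesis
      using IH var[OF Cons.prems(1) k] s by (auto intro!: sub_hyp simp: ren_conv_sub comp_def)
  next
    case (Dim d)
    have d: "is_dim d \<Delta> (Var k)" using k s Dim by (simp add: is_dim_def)
    show ?thesis
    proof (cases d)
      case Pth
      then show ?thesis using IH d Dim by (auto intro: sub_path)
    next
      case Brg
      \<comment> \<open>The remaining variables must be typed apart from index \<open>k\<close>, so
        the induction hypothesis is needed over the restricted context; this is why
        \<open>\<Delta>\<close> is generalised.\<close>
      have "R \<tturnstile> Sub (restrict k \<Delta>) (\<lambda>i. Var (i + Suc k)) \<Gamma>"
        using Cons.IH[of "restrict k \<Delta>" "Suc k"] Ctx_restrict[OF Cons.prems(1)] k tl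
        by (simp add: drop_restrict)
      then show ?thesis using Brg d Dim Cons.prems(1)
        by (auto intro!: sub_bridge simp: apart_def comp_def)
    qed
  next
    case (Cst d t u)
    have "is_face d \<Gamma> t u"
      using ctx[of k] Cons.prems(2) Cst by (auto elim: Ctx_CstE)
    with Cst show ?thesis
      using IH cst[OF Cons.prems(1) k] s by (auto intro!: sub_cst simp: ren_conv_sub comp_def)
  next
    case Dead
    then show ?thesis using IH by (auto intro: sub_dead)
  qed
qed

lemma Sub_id: "R \<tturnstile> Ctx \<Gamma> \<Longrightarrow> R \<tturnstile> Sub \<Gamma> Var \<Gamma>"
  using Sub_drop[of R \<Gamma> 0 \<Gamma>] by simp

lemma Sub_Suc: "R \<tturnstile> Ctx (s # \<Gamma>) \<Longrightarrow> R \<tturnstile> Sub (s # \<Gamma>) (\<lambda>i. Var (Suc i)) \<Gamma>"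
  using Sub_drop[of R "s # \<Gamma>" 1 \<Gamma>] by simp

lemma has_wk: "R \<tturnstile> Ctx (s # \<Gamma>) \<Longrightarrow> R \<tturnstile> \<Gamma> \<turnstile> M \<Colon> A \<Longrightarrow> R \<tturnstile> s # \<Gamma> \<turnstile> wk M \<Colon> wk A"
  using has_sub[OF Sub_Suc] by (simp add: ren_conv_sub)

text \<open>\<open>eq_sub\<close> demands an equality of substitutions even when the two coincide.
  Unlike \<open>Sub\<close>, this judgment imposes no apartness, so \<open>\<Delta>\<close> stays
  fixed.\<close>

lemma SubEq_drop: "R \<tturnstile> Ctx \<Delta> \<Longrightarrow> drop k \<Delta> = \<Gamma> \<Longrightarrow> R \<tturnstile> SubEq \<Delta> (\<lambda>i. Var (i + k)) (\<lambda>i. Var (i + k)) \<Gamma>"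
proof (induction \<Gamma> arbitrary: k)
  case Nil
  show ?case by (rule subeq_nil)
next
  case (Cons s \<Gamma>)
  have k: "k < length \<Delta>"
    using Cons.prems by (metis drop_eq_Nil2 linorder_not_le list.distinct(1))
  have s: "\<Delta> ! k = s" and tl: "drop (Suc k) \<Delta> = \<Gamma>"
    using Cons.prems by (auto simp: nth_via_drop drop_Suc simp flip: tl_drop)
  have IH: "R \<tturnstile> SubEq \<Delta> ((\<lambda>i. Var (i + k)) \<circ> Suc) ((\<lambda>i. Var (i + k)) \<circ> Suc) \<Gamma>"
    using Cons.IH[OF Cons.prems(1) tl] by (simp add: comp_def)
  show ?case
  proof (cases s)
    case (Hyp A)
    then show ?thesis
      using IH eq_refl[OF var[OF Cons.prems(1) k]] s
      by (auto intro!: subeq_hyp simp: ren_conv_sub comp_def)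
  next
    case (Dim d)
    then have "is_dim d \<Delta> (Var k)" using k s by (simp add: is_dim_def)
    then show ?thesis
      using IH Dim eq_refl[OF dim[OF Cons.prems(1)]] by (auto intro!: subeq_dim)
  qed (use IH in \<open>auto intro: subeq_cst subeq_dead\<close>)
qed

lemma eq_wk:
  assumes "R \<tturnstile> Ctx (s # \<Gamma>)" "R \<tturnstile> \<Gamma> \<turnstile> M \<doteq> N \<Colon> A"
  shows "R \<tturnstile> s # \<Gamma> \<turnstile> wk M \<doteq> wk N \<Colon> wk A"
  using eq_sub[OF Sub_Suc[OF assms(1)] Sub_Suc[OF assms(1)] _ assms(2)] SubEq_drop[OF assms(1), of 1]
  by (simp add: ren_conv_sub)

lemma is_dim_wk: "is_dim d \<Gamma> r \<Longrightarrow> is_dim d (s # \<Gamma>) (wk r)"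
  by (auto simp: is_dim_def)

text \<open>The new slot \<open>s\<close> need not survive \<open>apart\<close>: a term variable or
  an equation mentioning \<open>r\<close> turns into \<open>Dead\<close>. Hence some other slot
  \<open>s'\<close>.\<close>

lemma apart_wk:
  assumes "is_dim d \<Delta> r" "R \<tturnstile> Ctx (s # \<Delta>)"
  obtains s' where "apart (wk r) (s # \<Delta>) = s' # apart r \<Delta>" "R \<tturnstile> Ctx (s' # apart r \<Delta>)"
proof (cases "\<exists>n. r = Var n")
  case True
  then obtain n where n: "r = Var n" ..
  obtain s' where s': "restrict (Suc n) (s # \<Delta>) = s' # restrict n \<Delta>"
    by (cases s) auto
  show ?thesis
    using that[of s'] Ctx_restrict[OF assms(2), of "Suc n"] by (simp add: n apart_def s')
next
  case False
  then have "r = Zero d \<or> r = One d" using assms(1) by (auto simp: is_dim_def)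
  then show ?thesis using that[of s] assms(2) by (auto simp: apart_def)
qed

text \<open>The slot \<open>s\<close> is generalised because, at a bridge variable, the induction
  hypothesis is applied to whatever slot \<open>apart_wk\<close> leaves behind.\<close>

lemma Sub_wk:
  "R \<tturnstile> Sub \<Delta> \<sigma> \<Gamma> \<Longrightarrow> R \<tturnstile> Ctx (s # \<Delta>) \<Longrightarrow> R \<tturnstile> Sub (s # \<Delta>) (\<lambda>i. wk (\<sigma> i)) \<Gamma>"
proof (induction \<Gamma> arbitrary: \<Delta> \<sigma> s)
  case Nil
  then show ?case by (simp add: sub_nil)
next
  case (Cons c \<Gamma>)
  have tl: "R \<tturnstile> Sub (s # \<Delta>) ((\<lambda>i. wk (\<sigma> i)) \<circ> Suc) \<Gamma>" if "R \<tturnstile> Sub \<Delta> (\<sigma> \<circ> Suc) \<Gamma>"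
    using Cons.IH[OF that Cons.prems(2)] by (simp add: comp_def)
  have comm: "wk (sub \<tau> A) = sub (\<lambda>i. wk (\<tau> i)) A" for \<tau> and A :: "'a exp"
    by (simp add: ren_sub comp_def)
  show ?case
  proof (cases c)
    case (Hyp A)
    with Cons.prems(1) show ?thesis
      by (auto elim!: Sub_HypE intro!: sub_hyp tl dest: has_wk[OF Cons.prems(2)] simp: comm comp_def)
  next
    case (Dim d)
    show ?thesis
    proof (cases d)
      case Pth
      with Dim Cons.prems(1) show ?thesis
        by (auto elim!: Sub_DimE intro!: sub_path tl is_dim_wk)
    next
      case Brg
      with Dim Cons.prems(1) have r: "is_dim Brg \<Delta> (\<sigma> 0)"
        and sub: "R \<tturnstile> Sub (apart (\<sigma> 0) \<Delta>) (\<sigma> \<circ> Suc) \<Gamma>"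
        by (auto elim: Sub_DimE)
      from apart_wk[OF r Cons.prems(2)] obtain s' where
        s': "apart (wk (\<sigma> 0)) (s # \<Delta>) = s' # apart (\<sigma> 0) \<Delta>" "R \<tturnstile> Ctx (s' # apart (\<sigma> 0) \<Delta>)" .
      show ?thesis
        using Brg Dim Cons.IH[OF sub s'(2)] Cons.prems(2) is_dim_wk[OF r] s'(1)
        by (auto intro!: sub_bridge simp: comp_def)
    qed
  next
    case (Cst d t u)
    with Cons.prems(1) show ?thesis
      by (auto elim!: Sub_CstE intro!: sub_cst tl dest: eq_wk[OF Cons.prems(2)] simp: comm comp_def)
  next
    case Dead
    with Cons.prems(1) show ?thesis
      by (auto elim!: Sub_DeadE intro!: sub_dead tl)
  qed
qed

lemma up_Suc: "up \<sigma> \<circ> Suc = (\<lambda>i. wk (\<sigma> i))"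
  by (rule ext) (simp add: up_def)

text \<open>In the bridge case the old components must be typed apart from the new variable, that is
  over \<open>Dead # \<Delta>\<close>; weakening by a dead slot puts them there.\<close>

lemma Sub_up_Dim:
  assumes "R \<tturnstile> Ctx \<Delta>" "R \<tturnstile> Sub \<Delta> \<sigma> \<Gamma>"
  shows "R \<tturnstile> Sub (Dim d # \<Delta>) (up \<sigma>) (Dim d # \<Gamma>)"
proof (cases d)
  case Pth
  then show ?thesis
    by (auto intro!: sub_path Sub_wk assms ctx_dim simp: up_Suc) (simp add: up_def is_dim_def)
next
  case Brg
  have "R \<tturnstile> Sub (Dead # \<Delta>) (up \<sigma> \<circ> Suc) \<Gamma>"
    by (auto intro!: Sub_wk assms ctx_dead simp: up_Suc)
  moreover have "apart (up \<sigma> 0) (Dim Brg # \<Delta>) = Dead # \<Delta>"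
    by (simp add: apart_def up_def)
  ultimately show ?thesis using Brg
    by (auto intro!: sub_bridge ctx_dim assms) (simp add: up_def is_dim_def)
qed

lemma Sub_up_Hyp:
  assumes "R \<tturnstile> Ctx \<Delta>" "R \<tturnstile> Sub \<Delta> \<sigma> \<Gamma>" "R \<tturnstile> \<Gamma> \<turnstile> A \<Colon> Typ"
  shows "R \<tturnstile> Sub (Hyp (sub \<sigma> A) # \<Delta>) (up \<sigma>) (Hyp A # \<Gamma>)"
proof -
  have ctx: "R \<tturnstile> Ctx (Hyp (sub \<sigma> A) # \<Delta>)"
    using has_sub[OF assms(2,3)] assms(1) by (auto intro: ctx_hyp)
  show ?thesis
    using var[OF ctx, of 0] Sub_wk[OF assms(2) ctx]
    by (auto intro!: sub_hyp assms simp: up_Suc)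
      (simp add: up_def ren_sub comp_def)
qed

section \<open>Instantiation of the newest variable\<close>

lemma case_nat_Suc: "case_nat N \<sigma> \<circ> Suc = \<sigma>"
  by (simp add: comp_def)

lemma Sub_inst_Hyp:
  assumes "R \<tturnstile> Ctx \<Gamma>" "R \<tturnstile> \<Gamma> \<turnstile> A \<Colon> Typ" "R \<tturnstile> \<Gamma> \<turnstile> N \<Colon> A"
  shows "R \<tturnstile> Sub \<Gamma> (case_nat N Var) (Hyp A # \<Gamma>)"
  using assms by (auto intro!: sub_hyp Sub_id simp: case_nat_Suc)

text \<open>For bridges only the constants qualify: they are apart from all of
  \<open>\<Gamma>\<close>, whereas inserting a bridge variable of \<open>\<Gamma>\<close> would be a
  contraction.\<close>

lemma Sub_inst_Dim:
  assumes "R \<tturnstile> Ctx \<Gamma>" "r \<in> {Zero d, One d} \<or> d = Pth \<and> is_dim d \<Gamma> r"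
  shows "R \<tturnstile> Sub \<Gamma> (case_nat r Var) (Dim d # \<Gamma>)"
proof -
  have r: "is_dim d \<Gamma> r" using assms(2) by (auto simp: is_dim_def)
  show ?thesis
  proof (cases d)
    case Pth
    with r show ?thesis by (auto intro!: sub_path Sub_id assms simp: case_nat_Suc)
  next
    case Brg
    then have "apart r \<Gamma> = \<Gamma>" using assms(2) by (auto simp: apart_def)
    with Brg r show ?thesis by (auto intro!: sub_bridge Sub_id assms simp: case_nat_Suc)
  qed
qed

lemma has_inst_Hyp:
  assumes "R \<tturnstile> Ctx \<Gamma>" "R \<tturnstile> \<Gamma> \<turnstile> A \<Colon> Typ" "R \<tturnstile> \<Gamma> \<turnstile> N \<Colon> A" "R \<tturnstile> Hyp A # \<Gamma> \<turnstile> M \<Colon> B"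
  shows "R \<tturnstile> \<Gamma> \<turnstile> inst M N \<Colon> inst B N"
  unfolding inst_def using has_sub[OF Sub_inst_Hyp[OF assms(1-3)] assms(4)] .

lemma SubEq_id: "R \<tturnstile> Ctx \<Gamma> \<Longrightarrow> R \<tturnstile> SubEq \<Gamma> Var Var \<Gamma>"
  using SubEq_drop[of R \<Gamma> 0] by simp

lemma eq_inst_Hyp:
  assumes "R \<tturnstile> Ctx \<Gamma>" "R \<tturnstile> \<Gamma> \<turnstile> A \<Colon> Typ" "R \<tturnstile> \<Gamma> \<turnstile> N \<Colon> A" "R \<tturnstile> \<Gamma> \<turnstile> N' \<Colon> A"
    and "R \<tturnstile> \<Gamma> \<turnstile> N \<doteq> N' \<Colon> A" "R \<tturnstile> Hyp A # \<Gamma> \<turnstile> M \<doteq> M' \<Colon> B"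
  shows "R \<tturnstile> \<Gamma> \<turnstile> inst M N \<doteq> inst M' N' \<Colon> inst B N"
  unfolding inst_def
  by (rule eq_sub[OF Sub_inst_Hyp Sub_inst_Hyp _ assms(6)])
    (auto intro!: assms subeq_hyp SubEq_id simp: case_nat_Suc)

lemma has_inst_Dim:
  assumes "R \<tturnstile> Ctx \<Gamma>" "r \<in> {Zero d, One d} \<or> d = Pth \<and> is_dim d \<Gamma> r"
    and "R \<tturnstile> Dim d # \<Gamma> \<turnstile> M \<Colon> A"
  shows "R \<tturnstile> \<Gamma> \<turnstile> inst M r \<Colon> inst A r"
  unfolding inst_def using has_sub[OF Sub_inst_Dim[OF assms(1,2)] assms(3)] .

lemma eq_inst_Dim:
  assumes "R \<tturnstile> Ctx \<Gamma>" "r \<in> {Zero d, One d} \<or> d = Pth \<and> is_dim d \<Gamma> r"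
    and "R \<tturnstile> Dim d # \<Gamma> \<turnstile> M \<doteq> N \<Colon> A"
  shows "R \<tturnstile> \<Gamma> \<turnstile> inst M r \<doteq> inst N r \<Colon> inst A r"
proof -
  have "is_dim d \<Gamma> r" using assms(2) by (auto simp: is_dim_def)
  then have "R \<tturnstile> SubEq \<Gamma> (case_nat r Var) (case_nat r Var) (Dim d # \<Gamma>)"
    by (auto intro!: subeq_dim SubEq_id assms eq_refl dim simp: case_nat_Suc)
  then show ?thesis
    unfolding inst_def using eq_sub[OF Sub_inst_Dim[OF assms(1,2)] Sub_inst_Dim[OF assms(1,2)] _ assms(3)]
    by blast
qed

lemma Sub_wk_up_Dim:
  "R \<tturnstile> Ctx (s # \<Gamma>) \<Longrightarrow> R \<tturnstile> Sub (Dim d # s # \<Gamma>) (up (\<lambda>i. Var (Suc i))) (Dim d # \<Gamma>)"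
  by (intro Sub_up_Dim Sub_Suc)

lemma up_Var_Suc: "up (\<lambda>i. Var (\<rho> i)) = (\<lambda>i. Var (up_ren \<rho> i))"
  by (rule ext) (simp add: up_def up_ren_def split: nat.split)

lemma has_wk_Dim:
  "R \<tturnstile> Ctx (s # \<Gamma>) \<Longrightarrow> R \<tturnstile> Dim d # \<Gamma> \<turnstile> M \<Colon> A \<Longrightarrow>
    R \<tturnstile> Dim d # s # \<Gamma> \<turnstile> ren (up_ren Suc) M \<Colon> ren (up_ren Suc) A"
  using has_sub[OF Sub_wk_up_Dim] by (simp add: ren_conv_sub up_Var_Suc)

lemma Sub_wk_up_Hyp:
  "R \<tturnstile> Ctx (s # \<Gamma>) \<Longrightarrow> R \<tturnstile> \<Gamma> \<turnstile> A \<Colon> Typ \<Longrightarrow>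
    R \<tturnstile> Sub (Hyp (wk A) # s # \<Gamma>) (up (\<lambda>i. Var (Suc i))) (Hyp A # \<Gamma>)"
  unfolding ren_conv_sub by (intro Sub_up_Hyp Sub_Suc) auto

section \<open>Congruence\<close>

text \<open>The pattern of the congruence lemmas: take reflexivity of the operator applied to a
  generic variable and substitute the two equal terms for that variable.\<close>

lemma fst_cong:
  assumes "R \<tturnstile> Ctx \<Gamma>" "R \<tturnstile> \<Gamma> \<turnstile> Sigma A B \<Colon> Typ"
    and "R \<tturnstile> \<Gamma> \<turnstile> M \<Colon> Sigma A B" "R \<tturnstile> \<Gamma> \<turnstile> N \<Colon> Sigma A B" "R \<tturnstile> \<Gamma> \<turnstile> M \<doteq> N \<Colon> Sigma A B"
  shows "R \<tturnstile> \<Gamma> \<turnstile> Fst M \<doteq> Fst N \<Colon> A"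
proof -
  have "R \<tturnstile> Ctx (Hyp (Sigma A B) # \<Gamma>)" by (intro ctx_hyp assms)
  from var[OF this, of 0] have v: "R \<tturnstile> Hyp (Sigma A B) # \<Gamma> \<turnstile> Var 0 \<Colon> Sigma (wk A) (ren (up_ren Suc) B)"
    by simp
  from eq_inst_Hyp[OF assms eq_refl[OF fst[OF v]]] show ?thesis
    by (simp, simp add: inst_def)
qed

lemma snd_cong:
  assumes "R \<tturnstile> Ctx \<Gamma>" "R \<tturnstile> \<Gamma> \<turnstile> Sigma A B \<Colon> Typ"
    and "R \<tturnstile> \<Gamma> \<turnstile> M \<Colon> Sigma A B" "R \<tturnstile> \<Gamma> \<turnstile> N \<Colon> Sigma A B" "R \<tturnstile> \<Gamma> \<turnstile> M \<doteq> N \<Colon> Sigma A B"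
  shows "R \<tturnstile> \<Gamma> \<turnstile> Snd M \<doteq> Snd N \<Colon> inst B (Fst M)"
proof -
  have "R \<tturnstile> Ctx (Hyp (Sigma A B) # \<Gamma>)" by (intro ctx_hyp assms)
  from var[OF this, of 0] have v: "R \<tturnstile> Hyp (Sigma A B) # \<Gamma> \<turnstile> Var 0 \<Colon> Sigma (wk A) (ren (up_ren Suc) B)"
    by simp
  have "inst (inst (ren (up_ren Suc) B) (Fst (Var 0))) M = inst B (Fst M)"
    by (auto simp: subst_simps intro!: sub_cong split: nat.split)
  with eq_inst_Hyp[OF assms eq_refl[OF snd[OF v]]] show ?thesis
    by (simp add: inst_def)
qed

text \<open>The generic pair has two variables, the second with a type depending on the first, so
  both components are substituted simultaneously.\<close>

lemma pair_cong:
  assumes "R \<tturnstile> Ctx \<Gamma>" "R \<tturnstile> \<Gamma> \<turnstile> A \<Colon> Typ" "R \<tturnstile> Hyp A # \<Gamma> \<turnstile> B \<Colon> Typ"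
    and "R \<tturnstile> \<Gamma> \<turnstile> M \<Colon> A" "R \<tturnstile> \<Gamma> \<turnstile> M' \<Colon> A" "R \<tturnstile> \<Gamma> \<turnstile> N \<Colon> inst B M" "R \<tturnstile> \<Gamma> \<turnstile> N' \<Colon> inst B M'"
    and "R \<tturnstile> \<Gamma> \<turnstile> M \<doteq> M' \<Colon> A" "R \<tturnstile> \<Gamma> \<turnstile> N \<doteq> N' \<Colon> inst B M"
  shows "R \<tturnstile> \<Gamma> \<turnstile> Pair M N \<doteq> Pair M' N' \<Colon> Sigma A B"
proof -
  have ctx1: "R \<tturnstile> Ctx (Hyp A # \<Gamma>)" and ctx: "R \<tturnstile> Ctx (Hyp B # Hyp A # \<Gamma>)"
    by (intro ctx_hyp assms)+
  have A1: "R \<tturnstile> Hyp A # \<Gamma> \<turnstile> wk A \<Colon> Typ"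
    using has_wk[OF ctx1 assms(2)] by simp
  have A2: "R \<tturnstile> Hyp B # Hyp A # \<Gamma> \<turnstile> wk (wk A) \<Colon> Typ"
    using has_wk[OF ctx A1] by simp
  \<comment> \<open>\<open>B\<close> with its own variable kept and all older ones shifted past the
    two generic variables.\<close>
  define B' where "B' = sub (up (\<lambda>i. Var (Suc (Suc i)))) B"
  have "R \<tturnstile> Sub (Hyp (sub (\<lambda>i. Var (Suc (Suc i))) A) # Hyp B # Hyp A # \<Gamma>) (up (\<lambda>i. Var (Suc (Suc i)))) (Hyp A # \<Gamma>)"
    using Sub_drop[OF ctx, of 2] by (intro Sub_up_Hyp ctx assms) auto
  from has_sub[OF this assms(3)]
  have B': "R \<tturnstile> Hyp (wk (wk A)) # Hyp B # Hyp A # \<Gamma> \<turnstile> B' \<Colon> Typ"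
    by (simp add: B'_def ren_conv_sub sub_sub)
  have "R \<tturnstile> Hyp B # Hyp A # \<Gamma> \<turnstile> Var 1 \<Colon> wk (wk A)"
    using var[OF ctx, of 1] by (simp add: ren_conv_sub sub_sub)
  moreover have "inst B' (Var 1) = wk B"
    by (auto simp: B'_def subst_simps intro!: sub_cong split: nat.split)
  then have "R \<tturnstile> Hyp B # Hyp A # \<Gamma> \<turnstile> Var 0 \<Colon> inst B' (Var 1)"
    using var[OF ctx, of 0] by simp
  ultimately have p: "R \<tturnstile> Hyp B # Hyp A # \<Gamma> \<turnstile> Pair (Var 1) (Var 0) \<Colon> Sigma (wk (wk A)) B'"
    using pair[OF B'] by blast
  define \<sigma> where "\<sigma> = (\<lambda>M N. case_nat N (case_nat M (Var :: nat \<Rightarrow> 'a exp)))"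
  have S: "R \<tturnstile> Sub \<Gamma> (\<sigma> M N) (Hyp B # Hyp A # \<Gamma>)"
    if "R \<tturnstile> \<Gamma> \<turnstile> M \<Colon> A" "R \<tturnstile> \<Gamma> \<turnstile> N \<Colon> inst B M" for M N
    using that unfolding \<sigma>_def
    by (auto intro!: sub_hyp Sub_id assms simp: case_nat_Suc inst_def)
  have "R \<tturnstile> SubEq \<Gamma> (\<sigma> M N) (\<sigma> M' N') (Hyp B # Hyp A # \<Gamma>)"
    using assms(8,9) unfolding \<sigma>_def
    by (auto intro!: subeq_hyp SubEq_id assms(1) simp: case_nat_Suc inst_def)
  from eq_sub[OF S[OF assms(4,6)] S[OF assms(5,7)] this eq_refl[OF p]]
  have "R \<tturnstile> \<Gamma> \<turnstile> Pair M N \<doteq> Pair M' N' \<Colon> sub (\<sigma> M N) (Sigma (wk (wk A)) B')"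
    by (simp add: \<sigma>_def)
  moreover have "sub (\<sigma> M N) (wk (wk A)) = A"
    by (auto simp: \<sigma>_def subst_simps)
  moreover have "sub (up (\<sigma> M N)) B' = B"
    by (auto simp: \<sigma>_def B'_def subst_simps intro!: sub_id split: nat.split)
  ultimately show ?thesis by simp
qed

text \<open>This recovers a line of types, weakened under its binder, when a weakened bridge is
  applied to the fresh variable.\<close>

lemma inst_ren_up_Var: "inst (ren (up_ren Suc) A) (Var 0) = A"
  by (auto simp: subst_simps intro!: sub_id split: nat.split)

lemma app_Arr:
  "R \<tturnstile> \<Gamma> \<turnstile> F \<Colon> Arr A B \<Longrightarrow> R \<tturnstile> \<Gamma> \<turnstile> N \<Colon> A \<Longrightarrow> R \<tturnstile> \<Gamma> \<turnstile> App F N \<Colon> B"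
  unfolding Arr_def using app[of R \<Gamma> F A "wk B" N] by simp

section \<open>Substitution in derived types\<close>

lemma up_0 [simp]: "up \<sigma> 0 = Var 0"
  and up_Suc_apply [simp]: "up \<sigma> (Suc i) = wk (\<sigma> i)"
  by (simp_all add: up_def)

lemma sub_wk_up [simp]: "sub (up \<sigma>) (wk M) = wk (sub \<sigma> M)"
  by (simp add: sub_ren ren_sub up_Suc comp_def)

lemma inst_App [simp]: "inst (App M N) r = App (inst M r) (inst N r)"
  and inst_Pair [simp]: "inst (Pair M N) r = Pair (inst M r) (inst N r)"
  and inst_Fst [simp]: "inst (Fst M) r = Fst (inst M r)"
  and inst_Snd [simp]: "inst (Snd M) r = Snd (inst M r)"
  and inst_BApp [simp]: "inst (BApp M N) r = BApp (inst M r) (inst N r)"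
  and inst_PApp [simp]: "inst (PApp M N) r = PApp (inst M r) (inst N r)"
  and inst_Var_0 [simp]: "inst (Var 0) r = r"
  and inst_Zero [simp]: "inst (Zero d) r = Zero d"
  and inst_One [simp]: "inst (One d) r = One d"
  and inst_Typ [simp]: "inst Typ r = Typ"
  by (simp_all add: inst_def)

lemma sub_Arr [simp]: "sub \<sigma> (Arr A B) = Arr (sub \<sigma> A) (sub \<sigma> B)"
  by (simp add: Arr_def)

lemma ren_Arr [simp]: "ren \<rho> (Arr A B) = Arr (ren \<rho> A) (ren \<rho> B)"
  by (simp add: ren_conv_sub)

lemma sub_Id [simp]: "sub \<sigma> (Id A M N) = Id (sub \<sigma> A) (sub \<sigma> M) (sub \<sigma> N)"
  by (simp add: Id_def)

lemma sub_IsContr [simp]: "sub \<sigma> (IsContr A) = IsContr (sub \<sigma> A)"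
  by (simp add: IsContr_def)

lemma sub_Fiber [simp]: "sub \<sigma> (Fiber A B F b) = Fiber (sub \<sigma> A) (sub \<sigma> B) (sub \<sigma> F) (sub \<sigma> b)"
  by (simp add: Fiber_def)

lemma sub_IsEquiv [simp]: "sub \<sigma> (IsEquiv A B F) = IsEquiv (sub \<sigma> A) (sub \<sigma> B) (sub \<sigma> F)"
  by (simp add: IsEquiv_def)

lemma inst_Pi: "inst (Pi A B) r = Pi (inst A r) (sub (up (case_nat r Var)) B)"
  and inst_Sigma: "inst (Sigma A B) r = Sigma (inst A r) (sub (up (case_nat r Var)) B)"
  and inst_Id [simp]: "inst (Id A M N) r = Id (inst A r) (inst M r) (inst N r)"
  by (simp_all add: inst_def)

lemma ren_Id [simp]: "ren \<rho> (Id A M N) = Id (ren \<rho> A) (ren \<rho> M) (ren \<rho> N)"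
  and ren_Fiber [simp]: "ren \<rho> (Fiber A B F b) = Fiber (ren \<rho> A) (ren \<rho> B) (ren \<rho> F) (ren \<rho> b)"
  by (simp_all add: ren_conv_sub)

lemma app_cong:
  assumes "R \<tturnstile> Ctx \<Gamma>" "R \<tturnstile> \<Gamma> \<turnstile> A \<Colon> Typ" "R \<tturnstile> \<Gamma> \<turnstile> F \<Colon> Arr A B"
    and "R \<tturnstile> \<Gamma> \<turnstile> M \<Colon> A" "R \<tturnstile> \<Gamma> \<turnstile> N \<Colon> A" "R \<tturnstile> \<Gamma> \<turnstile> M \<doteq> N \<Colon> A"
  shows "R \<tturnstile> \<Gamma> \<turnstile> App F M \<doteq> App F N \<Colon> B"
proof -
  have ctx: "R \<tturnstile> Ctx (Hyp A # \<Gamma>)" by (intro ctx_hyp assms)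
  have "R \<tturnstile> Hyp A # \<Gamma> \<turnstile> App (wk F) (Var 0) \<Colon> wk B"
    using has_wk[OF ctx assms(3)] var[OF ctx, of 0] by (auto intro: app_Arr)
  from eq_inst_Hyp[OF assms(1,2,4-6) eq_refl[OF this]] show ?thesis by simp
qed

lemma sub_inst_wk [simp]: "sub (case_nat N Var) (wk M) = M"
  using inst_wk[of M N] by (simp add: inst_def)

lemma inst_PLam: "inst (PLam M) r = PLam (sub (up (case_nat r Var)) M)"
  by (simp add: inst_def)

section \<open>Homogeneous paths and the composite\<close>

lemma id_type:
  assumes "R \<tturnstile> Ctx \<Gamma>" "R \<tturnstile> \<Gamma> \<turnstile> A \<Colon> Typ" "R \<tturnstile> \<Gamma> \<turnstile> M \<Colon> A" "R \<tturnstile> \<Gamma> \<turnstile> N \<Colon> A"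
  shows "R \<tturnstile> \<Gamma> \<turnstile> Id A M N \<Colon> Typ"
  unfolding Id_def using assms has_wk[OF ctx_dim[OF assms(1)] assms(2)] by (auto intro!: path)

lemma id_plam:
  assumes "R \<tturnstile> Dim Pth # \<Gamma> \<turnstile> M \<Colon> wk A"
    and "R \<tturnstile> \<Gamma> \<turnstile> inst M (Zero Pth) \<doteq> M0 \<Colon> A" "R \<tturnstile> \<Gamma> \<turnstile> inst M (One Pth) \<doteq> M1 \<Colon> A"
  shows "R \<tturnstile> \<Gamma> \<turnstile> PLam M \<Colon> Id A M0 M1"
  unfolding Id_def using assms by (auto intro!: plam)

lemma id_papp:
  assumes "R \<tturnstile> \<Gamma> \<turnstile> Q \<Colon> Id A M N"
  shows "is_dim Pth \<Gamma> r \<Longrightarrow> R \<tturnstile> \<Gamma> \<turnstile> PApp Q r \<Colon> A"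
    and "R \<tturnstile> \<Gamma> \<turnstile> PApp Q (Zero Pth) \<doteq> M \<Colon> A"
    and "R \<tturnstile> \<Gamma> \<turnstile> PApp Q (One Pth) \<doteq> N \<Colon> A"
  using papp[OF assms[unfolded Id_def]] path_zero[OF assms[unfolded Id_def]]
    path_one[OF assms[unfolded Id_def]] by simp_all

lemma is_dim_const [simp]: "is_dim d \<Gamma> (Zero d)" "is_dim d \<Gamma> (One d)"
  by (simp_all add: is_dim_def)

lemma is_dim_Var_0 [simp]: "is_dim d (Dim d # \<Gamma>) (Var 0)"
  by (simp add: is_dim_def)

text \<open>\<open>filler B b p r s\<close> is the composite \<open>h r s\<close> of the introduction, for \<open>p\<close> a path to \<open>b\<close> in \<open>B\<close>.\<close>

definition filler :: "'c exp \<Rightarrow> 'c exp \<Rightarrow> 'c exp \<Rightarrow> 'c exp \<Rightarrow> 'c exp \<Rightarrow> 'c exp" where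
  "filler B b p r s = Hcom B (One Pth) s b
     [Tube Pth r (Zero Pth) (wk b), Tube Pth r (One Pth) (PApp (wk p) (Var 0))]"

lemma sub_filler [simp]:
  "sub \<sigma> (filler B b p r s) = filler (sub \<sigma> B) (sub \<sigma> b) (sub \<sigma> p) (sub \<sigma> r) (sub \<sigma> s)"
  by (simp add: filler_def)

lemma ren_filler [simp]:
  "ren \<rho> (filler B b p r s) = filler (ren \<rho> B) (ren \<rho> b) (ren \<rho> p) (ren \<rho> r) (ren \<rho> s)"
  by (simp add: ren_conv_sub)

lemma inst_filler [simp]:
  "inst (filler B b p r s) t = filler (inst B t) (inst b t) (inst p t) (inst r t) (inst s t)"
  by (simp add: inst_def)

lemma is_dim_is_face: "is_dim Pth \<Gamma> r \<Longrightarrow> is_dim Pth \<Gamma> s \<Longrightarrow> is_face Pth \<Gamma> r s"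
  by (simp add: is_face_def)

text \<open>Both tubes match the cap at \<open>1\<close>, the second because \<open>p\<close> ends
  at \<open>b\<close>. Two different tubes agree vacuously, as their faces \<open>r = 0\<close> and
  \<open>r = 1\<close> together give \<open>0 = 1\<close>.\<close>

lemma filler_sys:
  assumes ctx: "R \<tturnstile> Ctx \<Gamma>" and B: "R \<tturnstile> \<Gamma> \<turnstile> B \<Colon> Typ" and b: "R \<tturnstile> \<Gamma> \<turnstile> b \<Colon> B"
    and p: "R \<tturnstile> \<Gamma> \<turnstile> p \<Colon> Id B c b" and r: "is_dim Pth \<Gamma> r"
  shows "R \<tturnstile> Sys \<Gamma> B (One Pth) b
    [Tube Pth r (Zero Pth) (wk b), Tube Pth r (One Pth) (PApp (wk p) (Var 0))]"
proof -
  let ?T0 = "Tube Pth r (Zero Pth) (wk b)" and ?T1 = "Tube Pth r (One Pth) (PApp (wk p) (Var 0))"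
  let ?S = "set [?T0, ?T1]" and ?D = "Dim Pth # \<Gamma>"
  have ctxD: "R \<tturnstile> Ctx ?D" by (intro ctx_dim ctx)
  \<comment> \<open>Both bodies make sense without their faces, so every typing over a face is a
    mere weakening.\<close>
  have body: "R \<tturnstile> ?D \<turnstile> tbody T \<Colon> wk B" if "T \<in> ?S" for T
    using that has_wk[OF ctxD b] id_papp(1)[OF has_wk[OF ctxD p, simplified]] by auto
  have face: "is_dim Pth \<Gamma> (tlhs T)" "is_dim Pth \<Gamma> (trhs T)" "tsort T = Pth" if "T \<in> ?S" for T
    using that r by auto
  have ctxF: "R \<tturnstile> Ctx (Cst Pth (wk (tlhs T)) (wk (trhs T)) # ?D)" if "T \<in> ?S" for T
    using face[OF that] by (intro ctx_cst ctxD is_dim_is_face is_dim_wk)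
  have ctxF': "R \<tturnstile> Ctx (Cst Pth (tlhs T) (trhs T) # \<Gamma>)" if "T \<in> ?S" for T
    using face[OF that] by (intro ctx_cst ctx is_dim_is_face)
  have ctxFF: "R \<tturnstile> Ctx (Cst Pth (wk (wk (tlhs U))) (wk (wk (trhs U))) #
      Cst Pth (wk (tlhs T)) (wk (trhs T)) # ?D)" if "T \<in> ?S" "U \<in> ?S" for T U
    using face[OF that(2)] by (intro ctx_cst[OF ctxF[OF that(1)]] is_dim_is_face is_dim_wk)
  have bodyF: "R \<tturnstile> Cst Pth (wk (tlhs T)) (wk (trhs T)) # ?D \<turnstile> wk (tbody T') \<Colon> wk (wk B)"
    if "T \<in> ?S" "T' \<in> ?S" for T T'
    using has_wk[OF ctxF[OF that(1)] body[OF that(2)]] .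
  have cap: "R \<tturnstile> \<Gamma> \<turnstile> inst (tbody T) (One Pth) \<doteq> b \<Colon> B" if "T \<in> ?S" for T
    using that id_papp(3)[OF p] b by (auto intro: eq_refl)
  have compat: "R \<tturnstile> Cst Pth (wk (wk (tlhs U))) (wk (wk (trhs U))) #
      Cst Pth (wk (tlhs T)) (wk (trhs T)) # ?D
      \<turnstile> wk (wk (tbody T)) \<doteq> wk (wk (tbody U)) \<Colon> wk (wk (wk B))"
    (is "R \<tturnstile> ?E T U \<turnstile> _ \<doteq> _ \<Colon> _")
    if TU: "T \<in> ?S" "U \<in> ?S" for T U
  proof -
    have has: "R \<tturnstile> ?E T U \<turnstile> wk (wk (tbody T')) \<Colon> wk (wk (wk B))" if "T' \<in> ?S" for T'
      using has_wk[OF ctxFF[OF TU] bodyF[OF TU(1) that]] .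
    show ?thesis
    proof (cases "T = U")
      case True
      then show ?thesis using has[OF TU(1)] by (auto intro: eq_refl)
    next
      case False
      \<comment> \<open>Slot 0 is the face of \<open>U\<close> and slot 1 the face of
        \<open>T\<close>. Both equate \<open>r\<close> with a constant, and for different tubes the
        constants differ.\<close>
      have "R \<tturnstile> ?E T U \<turnstile> wk (wk (wk r)) \<doteq> wk (wk (wk (trhs U))) \<Colon> Interval Pth"
        using cst[OF ctxFF[OF TU], of 0] TU by (auto simp: ren_conv_sub sub_sub)
      moreover have "R \<tturnstile> ?E T U \<turnstile> wk (wk (wk r)) \<doteq> wk (wk (wk (trhs T))) \<Colon> Interval Pth"
        using cst[OF ctxFF[OF TU], of 1] TU by (auto simp: ren_conv_sub sub_sub)
      ultimately have "R \<tturnstile> ?E T U \<turnstile> wk (wk (wk (trhs T))) \<doteq> wk (wk (wk (trhs U))) \<Colon> Interval Pth"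
        by (blast intro: eq_sym eq_trans)
      then have "R \<tturnstile> ?E T U \<turnstile> Zero Pth \<doteq> One Pth \<Colon> Interval Pth"
        using TU False by (auto intro: eq_sym)
      then show ?thesis using has TU by (blast intro: absurd)
    qed
  qed
  show ?thesis
  proof (rule sys[OF B is_dim_const(2) b]; intro ballI)
    fix T assume T: "T \<in> ?S"
    note sort = face(3)[OF T]
    show "is_face (tsort T) \<Gamma> (tlhs T) (trhs T)"
      using face[OF T] by (simp add: is_dim_is_face)
    show "R \<tturnstile> Cst (tsort T) (wk (tlhs T)) (wk (trhs T)) # ?D \<turnstile> wk (tbody T) \<Colon> wk (wk B)"
      unfolding sort by (rule bodyF[OF T T])
    show "R \<tturnstile> Cst (tsort T) (tlhs T) (trhs T) # \<Gamma> \<turnstile> wk (inst (tbody T) (One Pth)) \<doteq> wk b \<Colon> wk B"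
      unfolding sort by (rule eq_wk[OF ctxF'[OF T] cap[OF T]])
    fix U assume U: "U \<in> ?S"
    show "R \<tturnstile> Cst (tsort U) (wk (wk (tlhs U))) (wk (wk (trhs U))) #
        Cst (tsort T) (wk (tlhs T)) (wk (trhs T)) # ?D
        \<turnstile> wk (wk (tbody T)) \<doteq> wk (wk (tbody U)) \<Colon> wk (wk (wk B))"
      unfolding sort face(3)[OF U] by (rule compat[OF T U])
  qed
qed

lemma filler_has:
  assumes "R \<tturnstile> Ctx \<Gamma>" "R \<tturnstile> \<Gamma> \<turnstile> B \<Colon> Typ" "R \<tturnstile> \<Gamma> \<turnstile> b \<Colon> B" "R \<tturnstile> \<Gamma> \<turnstile> p \<Colon> Id B c b"
    and "is_dim Pth \<Gamma> r" "is_dim Pth \<Gamma> s"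
  shows "R \<tturnstile> \<Gamma> \<turnstile> filler B b p r s \<Colon> B"
  unfolding filler_def by (rule hcom[OF filler_sys[OF assms(1-5)] assms(6)])

lemma filler_cap:
  assumes "R \<tturnstile> Ctx \<Gamma>" "R \<tturnstile> \<Gamma> \<turnstile> B \<Colon> Typ" "R \<tturnstile> \<Gamma> \<turnstile> b \<Colon> B" "R \<tturnstile> \<Gamma> \<turnstile> p \<Colon> Id B c b"
    and "is_dim Pth \<Gamma> r"
  shows "R \<tturnstile> \<Gamma> \<turnstile> filler B b p r (One Pth) \<doteq> b \<Colon> B"
  unfolding filler_def by (rule hcom_cap[OF filler_sys[OF assms]])

lemma filler_zero:
  assumes "R \<tturnstile> Ctx \<Gamma>" "R \<tturnstile> \<Gamma> \<turnstile> B \<Colon> Typ" "R \<tturnstile> \<Gamma> \<turnstile> b \<Colon> B" "R \<tturnstile> \<Gamma> \<turnstile> p \<Colon> Id B c b"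
    and "is_dim Pth \<Gamma> s"
  shows "R \<tturnstile> \<Gamma> \<turnstile> filler B b p (Zero Pth) s \<doteq> b \<Colon> B"
  unfolding filler_def
  using hcom_tube[OF filler_sys[OF assms(1-4)] assms(5), of "Zero Pth" Pth "Zero Pth" "Zero Pth" "wk b"]
    eq_refl[OF dim[OF assms(1)], of Pth "Zero Pth"] by simp

lemma filler_one:
  assumes "R \<tturnstile> Ctx \<Gamma>" "R \<tturnstile> \<Gamma> \<turnstile> B \<Colon> Typ" "R \<tturnstile> \<Gamma> \<turnstile> b \<Colon> B" "R \<tturnstile> \<Gamma> \<turnstile> p \<Colon> Id B c b"
    and "is_dim Pth \<Gamma> s"
  shows "R \<tturnstile> \<Gamma> \<turnstile> filler B b p (One Pth) s \<doteq> PApp p s \<Colon> B"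
  unfolding filler_def
  using hcom_tube[OF filler_sys[OF assms(1-4)] assms(5), of "One Pth" Pth "One Pth" "One Pth" "PApp (wk p) (Var 0)"]
    eq_refl[OF dim[OF assms(1)], of Pth "One Pth"] by simp

section \<open>Contractible types, fibres and equivalences\<close>

lemma var_0: "R \<tturnstile> Ctx (Hyp A # \<Gamma>) \<Longrightarrow> R \<tturnstile> Hyp A # \<Gamma> \<turnstile> Var 0 \<Colon> wk A"
  using var[of R "Hyp A # \<Gamma>" 0] by simp

lemma var_1: "R \<tturnstile> Ctx (s # Hyp A # \<Gamma>) \<Longrightarrow> R \<tturnstile> s # Hyp A # \<Gamma> \<turnstile> Var (Suc 0) \<Colon> wk (wk A)"
  using var[of R "s # Hyp A # \<Gamma>" 1] by (simp add: ren_conv_sub sub_sub)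

lemma is_contr_snd_type:
  assumes "R \<tturnstile> Ctx \<Gamma>" "R \<tturnstile> \<Gamma> \<turnstile> A \<Colon> Typ"
  shows "R \<tturnstile> Hyp A # \<Gamma> \<turnstile> Pi (wk A) (Id (wk (wk A)) (Var 1) (Var 0)) \<Colon> Typ"
proof -
  have 1: "R \<tturnstile> Ctx (Hyp A # \<Gamma>)" by (intro ctx_hyp assms)
  have A1: "R \<tturnstile> Hyp A # \<Gamma> \<turnstile> wk A \<Colon> Typ" using has_wk[OF 1 assms(2)] by simp
  have 2: "R \<tturnstile> Ctx (Hyp (wk A) # Hyp A # \<Gamma>)" by (intro ctx_hyp 1 A1)
  have A2: "R \<tturnstile> Hyp (wk A) # Hyp A # \<Gamma> \<turnstile> wk (wk A) \<Colon> Typ" using has_wk[OF 2 A1] by simp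
  show ?thesis
    using A1 id_type[OF 2 A2 var_1[OF 2] var_0[OF 2]] by (auto intro: pi)
qed

lemma is_contr_type:
  "R \<tturnstile> Ctx \<Gamma> \<Longrightarrow> R \<tturnstile> \<Gamma> \<turnstile> A \<Colon> Typ \<Longrightarrow> R \<tturnstile> \<Gamma> \<turnstile> IsContr A \<Colon> Typ"
  unfolding IsContr_def using is_contr_snd_type[of R \<Gamma> A] by (auto intro!: sigma)

lemma is_contrI:
  assumes "R \<tturnstile> Ctx \<Gamma>" "R \<tturnstile> \<Gamma> \<turnstile> A \<Colon> Typ" "R \<tturnstile> \<Gamma> \<turnstile> c \<Colon> A"
    and "R \<tturnstile> Hyp A # \<Gamma> \<turnstile> q \<Colon> Id (wk A) (wk c) (Var 0)"
  shows "R \<tturnstile> \<Gamma> \<turnstile> Pair c (Lam q) \<Colon> IsContr A"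
proof -
  have "inst (Pi (wk A) (Id (wk (wk A)) (Var 1) (Var 0))) c = Pi A (Id (wk A) (wk c) (Var 0))"
    by (simp add: inst_Pi)
  then show ?thesis
    unfolding IsContr_def
    using pair[OF is_contr_snd_type[OF assms(1,2)] assms(3)] lam[OF assms(4)] by simp
qed

lemma fiber_snd_type:
  assumes "R \<tturnstile> Ctx \<Gamma>" "R \<tturnstile> \<Gamma> \<turnstile> A \<Colon> Typ" "R \<tturnstile> \<Gamma> \<turnstile> B \<Colon> Typ" "R \<tturnstile> \<Gamma> \<turnstile> F \<Colon> Arr A B"
    "R \<tturnstile> \<Gamma> \<turnstile> b \<Colon> B"
  shows "R \<tturnstile> Hyp A # \<Gamma> \<turnstile> Id (wk B) (App (wk F) (Var 0)) (wk b) \<Colon> Typ"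
proof -
  have 1: "R \<tturnstile> Ctx (Hyp A # \<Gamma>)" by (intro ctx_hyp assms)
  show ?thesis
    using has_wk[OF 1 assms(3)] has_wk[OF 1 assms(4)] has_wk[OF 1 assms(5)] var_0[OF 1]
    by (auto intro!: id_type 1 app_Arr)
qed

lemma fiber_type:
  assumes "R \<tturnstile> Ctx \<Gamma>" "R \<tturnstile> \<Gamma> \<turnstile> A \<Colon> Typ" "R \<tturnstile> \<Gamma> \<turnstile> B \<Colon> Typ" "R \<tturnstile> \<Gamma> \<turnstile> F \<Colon> Arr A B"
    "R \<tturnstile> \<Gamma> \<turnstile> b \<Colon> B"
  shows "R \<tturnstile> \<Gamma> \<turnstile> Fiber A B F b \<Colon> Typ"
  unfolding Fiber_def using fiber_snd_type[OF assms] assms(2) by (auto intro!: sigma)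

lemma fiber_pair:
  assumes "R \<tturnstile> Ctx \<Gamma>" "R \<tturnstile> \<Gamma> \<turnstile> A \<Colon> Typ" "R \<tturnstile> \<Gamma> \<turnstile> B \<Colon> Typ" "R \<tturnstile> \<Gamma> \<turnstile> F \<Colon> Arr A B"
    "R \<tturnstile> \<Gamma> \<turnstile> b \<Colon> B" and "R \<tturnstile> \<Gamma> \<turnstile> a \<Colon> A" "R \<tturnstile> \<Gamma> \<turnstile> p \<Colon> Id B (App F a) b"
  shows "R \<tturnstile> \<Gamma> \<turnstile> Pair a p \<Colon> Fiber A B F b"
  unfolding Fiber_def using assms by (auto intro!: pair fiber_snd_type)

lemma fiber_fst: "R \<tturnstile> \<Gamma> \<turnstile> f \<Colon> Fiber A B F b \<Longrightarrow> R \<tturnstile> \<Gamma> \<turnstile> Fst f \<Colon> A"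
  unfolding Fiber_def by (rule fst)

lemma fiber_snd: "R \<tturnstile> \<Gamma> \<turnstile> f \<Colon> Fiber A B F b \<Longrightarrow> R \<tturnstile> \<Gamma> \<turnstile> Snd f \<Colon> Id B (App F (Fst f)) b"
  unfolding Fiber_def by (drule snd) simp

lemma is_equiv_type:
  assumes "R \<tturnstile> Ctx \<Gamma>" "R \<tturnstile> \<Gamma> \<turnstile> A \<Colon> Typ" "R \<tturnstile> \<Gamma> \<turnstile> B \<Colon> Typ" "R \<tturnstile> \<Gamma> \<turnstile> F \<Colon> Arr A B"
  shows "R \<tturnstile> \<Gamma> \<turnstile> IsEquiv A B F \<Colon> Typ"
proof -
  have 1: "R \<tturnstile> Ctx (Hyp B # \<Gamma>)" by (intro ctx_hyp assms)
  show ?thesis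
    unfolding IsEquiv_def using assms(3) var_0[OF 1]
      has_wk[OF 1 assms(2)] has_wk[OF 1 assms(3)] has_wk[OF 1 assms(4)]
    by (auto intro!: pi is_contr_type fiber_type 1)
qed

lemma arr_type:
  assumes "R \<tturnstile> Ctx \<Gamma>" "R \<tturnstile> \<Gamma> \<turnstile> A \<Colon> Typ" "R \<tturnstile> \<Gamma> \<turnstile> B \<Colon> Typ"
  shows "R \<tturnstile> \<Gamma> \<turnstile> Arr A B \<Colon> Typ"
proof -
  have 1: "R \<tturnstile> Ctx (Hyp A # \<Gamma>)" by (intro ctx_hyp assms)
  show ?thesis
    unfolding Arr_def using assms(2) has_wk[OF 1 assms(3)] by (auto intro!: pi)
qed

lemma equivI:
  assumes ctx: "R \<tturnstile> Ctx \<Gamma>" and A: "R \<tturnstile> \<Gamma> \<turnstile> A \<Colon> Typ" and B: "R \<tturnstile> \<Gamma> \<turnstile> B \<Colon> Typ"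
    and F: "R \<tturnstile> \<Gamma> \<turnstile> F \<Colon> Arr A B"
    and c: "R \<tturnstile> Hyp B # \<Gamma> \<turnstile> c \<Colon> IsContr (Fiber (wk A) (wk B) (wk F) (Var 0))"
  shows "R \<tturnstile> \<Gamma> \<turnstile> Pair F (Lam c) \<Colon> Equiv A B"
proof -
  have 1: "R \<tturnstile> Ctx (Hyp (Arr A B) # \<Gamma>)" by (intro ctx_hyp arr_type ctx A B)
  have "R \<tturnstile> Hyp (Arr A B) # \<Gamma> \<turnstile> IsEquiv (wk A) (wk B) (Var 0) \<Colon> Typ"
    using has_wk[OF 1 A] has_wk[OF 1 B] var_0[OF 1] by (auto intro!: is_equiv_type 1)
  moreover have "inst (IsEquiv (wk A) (wk B) (Var 0)) F = IsEquiv A B F"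
    by (simp add: inst_def sub_ren comp_def)
  moreover have "R \<tturnstile> \<Gamma> \<turnstile> Lam c \<Colon> IsEquiv A B F"
    unfolding IsEquiv_def by (rule lam[OF c])
  ultimately show ?thesis
    unfolding Equiv_def using F by (auto intro: pair)
qed

section \<open>Judgmental isomorphisms are equivalences\<close>

text \<open>The inverse laws are assumed for a generic variable, not for all terms over
  \<open>\<Gamma>\<close>: only this form carries over to longer contexts (\<open>weaken\<close>).
  \<open>GF\<close> and \<open>FG\<close> recover them at each term.\<close>

locale judgmental_iso =
  fixes R :: "('c jdg set \<times> 'c jdg) set" and \<Gamma> :: "'c ctx" and A B F G :: "'c exp"
  assumes ctx: "R \<tturnstile> Ctx \<Gamma>"
    and A: "R \<tturnstile> \<Gamma> \<turnstile> A \<Colon> Typ" and B: "R \<tturnstile> \<Gamma> \<turnstile> B \<Colon> Typ"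
    and F: "R \<tturnstile> \<Gamma> \<turnstile> F \<Colon> Arr A B" and G: "R \<tturnstile> \<Gamma> \<turnstile> G \<Colon> Arr B A"
    and GF_var: "R \<tturnstile> Hyp A # \<Gamma> \<turnstile> App (wk G) (App (wk F) (Var 0)) \<doteq> Var 0 \<Colon> wk A"
    and FG_var: "R \<tturnstile> Hyp B # \<Gamma> \<turnstile> App (wk F) (App (wk G) (Var 0)) \<doteq> Var 0 \<Colon> wk B"
begin

lemma GF: "R \<tturnstile> \<Gamma> \<turnstile> a \<Colon> A \<Longrightarrow> R \<tturnstile> \<Gamma> \<turnstile> App G (App F a) \<doteq> a \<Colon> A"
  using eq_inst_Hyp[OF ctx A _ _ eq_refl GF_var] by simp

lemma FG: "R \<tturnstile> \<Gamma> \<turnstile> b \<Colon> B \<Longrightarrow> R \<tturnstile> \<Gamma> \<turnstile> App F (App G b) \<doteq> b \<Colon> B"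
  using eq_inst_Hyp[OF ctx B _ _ eq_refl FG_var] by simp

lemma app_F: "R \<tturnstile> \<Gamma> \<turnstile> a \<Colon> A \<Longrightarrow> R \<tturnstile> \<Gamma> \<turnstile> App F a \<Colon> B"
  using F by (rule app_Arr)

lemma app_G: "R \<tturnstile> \<Gamma> \<turnstile> b \<Colon> B \<Longrightarrow> R \<tturnstile> \<Gamma> \<turnstile> App G b \<Colon> A"
  using G by (rule app_Arr)

lemma weaken:
  assumes "R \<tturnstile> Ctx (s # \<Gamma>)"
  shows "judgmental_iso R (s # \<Gamma>) (wk A) (wk B) (wk F) (wk G)"
proof -
  have *: "R \<tturnstile> Hyp (wk X) # s # \<Gamma> \<turnstile> App (wk (wk K)) (App (wk (wk H)) (Var 0)) \<doteq> Var 0 \<Colon> wk (wk X)"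
    if X: "R \<tturnstile> \<Gamma> \<turnstile> X \<Colon> Typ"
      and e: "R \<tturnstile> Hyp X # \<Gamma> \<turnstile> App (wk K) (App (wk H) (Var 0)) \<doteq> Var 0 \<Colon> wk X" for X H K
  proof -
    have 1: "R \<tturnstile> Ctx (Hyp X # \<Gamma>)" by (intro ctx_hyp X ctx)
    have "R \<tturnstile> s # \<Gamma> \<turnstile> wk X \<Colon> Typ" using has_wk[OF assms X] by simp
    then have 2: "R \<tturnstile> Ctx (Hyp (wk X) # s # \<Gamma>)" by (intro ctx_hyp assms)
    let ?\<sigma> = "up (\<lambda>i. Var (Suc i))"
    have S: "R \<tturnstile> Sub (Hyp (wk X) # s # \<Gamma>) ?\<sigma> (Hyp X # \<Gamma>)"
      by (rule Sub_wk_up_Hyp[OF assms X])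
    \<comment> \<open>Apart from index 0, the lifted weakening adds 2 in the end: one for
      \<open>s\<close> and one for the copy of the bound variable.\<close>
    have "R \<tturnstile> SubEq (Hyp (wk X) # s # \<Gamma>) ?\<sigma> ?\<sigma> (Hyp X # \<Gamma>)"
      using SubEq_drop[OF 2, of 2] eq_refl[OF var_0[OF 2]]
      by (auto intro!: subeq_hyp simp: up_Suc) (simp_all add: ren_conv_sub sub_sub)
    from eq_sub[OF S S this e] show ?thesis by (simp add: ren_conv_sub[symmetric])
  qed
  show ?thesis
    by unfold_locales
      (use assms has_wk[OF assms A] has_wk[OF assms B] has_wk[OF assms F] has_wk[OF assms G]
        *[OF A GF_var] *[OF B FG_var] in simp_all)
qed

definition "contraction b f r = Pair (App G (filler B b (Snd f) r (Zero Pth)))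
  (PLam (filler (wk B) (wk b) (wk (Snd f)) (wk r) (Var 0)))"

text \<open>The constant path starts at \<open>b\<close>, which is \<open>F (G b)\<close> only up to
  \<open>FG\<close>.\<close>

lemma center_has:
  assumes b: "R \<tturnstile> \<Gamma> \<turnstile> b \<Colon> B"
  shows "R \<tturnstile> \<Gamma> \<turnstile> Pair (App G b) (PLam (wk b)) \<Colon> Fiber A B F b"
  using has_wk[OF ctx_dim[OF ctx] b] FG[OF b] b
  by (intro fiber_pair ctx A B F b app_G id_plam) (auto intro: eq_sym eq_refl)

text \<open>The starting point \<open>a\<close> is left open up to equality because in the fibre it
  must have the form \<open>F (G (h r 0))\<close>.\<close>

lemma filler_path:
  assumes b: "R \<tturnstile> \<Gamma> \<turnstile> b \<Colon> B" and p: "R \<tturnstile> \<Gamma> \<turnstile> p \<Colon> Id B c b" and r: "is_dim Pth \<Gamma> r"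
  shows "R \<tturnstile> Dim Pth # \<Gamma> \<turnstile> filler (wk B) (wk b) (wk p) (wk r) (Var 0) \<Colon> wk B"
    and "R \<tturnstile> \<Gamma> \<turnstile> filler B b p r (Zero Pth) \<doteq> a \<Colon> B \<Longrightarrow>
      R \<tturnstile> \<Gamma> \<turnstile> PLam (filler (wk B) (wk b) (wk p) (wk r) (Var 0)) \<Colon> Id B a b"
proof -
  have D: "R \<tturnstile> Ctx (Dim Pth # \<Gamma>)" by (intro ctx_dim ctx)
  show *: "R \<tturnstile> Dim Pth # \<Gamma> \<turnstile> filler (wk B) (wk b) (wk p) (wk r) (Var 0) \<Colon> wk B"
    using has_wk[OF D B] has_wk[OF D b] has_wk[OF D p] is_dim_wk[OF r]
    by (intro filler_has D) auto
  show "R \<tturnstile> \<Gamma> \<turnstile> PLam (filler (wk B) (wk b) (wk p) (wk r) (Var 0)) \<Colon> Id B a b"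
    if "R \<tturnstile> \<Gamma> \<turnstile> filler B b p r (Zero Pth) \<doteq> a \<Colon> B"
    using that filler_cap[OF ctx B b p r] by (intro id_plam *) simp_all
qed

text \<open>The path \<open>h r s\<close> in \<open>s\<close> starts at \<open>h r 0\<close>, which
  \<open>FG\<close> turns into \<open>F (G (h r 0))\<close>. At \<open>r = 0\<close> the composite
  is constantly \<open>b\<close>. At \<open>r = 1\<close> it is \<open>p\<close>, so its start is
  \<open>F (Fst f)\<close>, the first component is \<open>Fst f\<close> by \<open>GF\<close>, and
  the second is \<open>p\<close> by path eta.\<close>

lemma contraction:
  assumes b: "R \<tturnstile> \<Gamma> \<turnstile> b \<Colon> B" and f: "R \<tturnstile> \<Gamma> \<turnstile> f \<Colon> Fiber A B F b"
  shows contraction_has: "is_dim Pth \<Gamma> r \<Longrightarrow> R \<tturnstile> \<Gamma> \<turnstile> contraction b f r \<Colon> Fiber A B F b"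
    and contraction_zero: "R \<tturnstile> \<Gamma> \<turnstile> contraction b f (Zero Pth) \<doteq> Pair (App G b) (PLam (wk b)) \<Colon> Fiber A B F b"
    and contraction_one: "R \<tturnstile> \<Gamma> \<turnstile> contraction b f (One Pth) \<doteq> f \<Colon> Fiber A B F b"
proof -
  define p where "p = Snd f"
  define P where "P r = PLam (filler (wk B) (wk b) (wk p) (wk r) (Var 0))" for r
  define y where "y r = filler B b p r (Zero Pth)" for r
  have D: "R \<tturnstile> Ctx (Dim Pth # \<Gamma>)" by (intro ctx_dim ctx)
  have contr: "contraction b f r = Pair (App G (y r)) (P r)" for r
    by (simp add: contraction_def p_def P_def y_def)
  have a: "R \<tturnstile> \<Gamma> \<turnstile> Fst f \<Colon> A" by (rule fiber_fst[OF f])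
  have p: "R \<tturnstile> \<Gamma> \<turnstile> p \<Colon> Id B (App F (Fst f)) b" unfolding p_def by (rule fiber_snd[OF f])
  have y: "R \<tturnstile> \<Gamma> \<turnstile> y r \<Colon> B" if "is_dim Pth \<Gamma> r" for r
    unfolding y_def using filler_has[OF ctx B b p that] by simp
  have y0: "R \<tturnstile> \<Gamma> \<turnstile> y (Zero Pth) \<doteq> b \<Colon> B"
    unfolding y_def using filler_zero[OF ctx B b p] by simp
  have "R \<tturnstile> \<Gamma> \<turnstile> y (One Pth) \<doteq> PApp p (Zero Pth) \<Colon> B"
    unfolding y_def using filler_one[OF ctx B b p] by simp
  then have y1: "R \<tturnstile> \<Gamma> \<turnstile> y (One Pth) \<doteq> App F (Fst f) \<Colon> B"
    using id_papp(2)[OF p] by (rule eq_trans)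
  have P: "R \<tturnstile> \<Gamma> \<turnstile> P r \<Colon> Id B (App F (App G (y r))) b" if "is_dim Pth \<Gamma> r" for r
    using eq_sym[OF FG[OF y[OF that]]] unfolding P_def y_def by (rule filler_path(2)[OF b p that])
  show has: "R \<tturnstile> \<Gamma> \<turnstile> contraction b f r \<Colon> Fiber A B F b" if "is_dim Pth \<Gamma> r" for r
    unfolding contr using that by (intro fiber_pair ctx A B F b app_G y P)
  note wks = has_wk[OF D B, simplified] has_wk[OF D b] has_wk[OF D p, simplified]
  let ?v = "Var 0"
  have body: "R \<tturnstile> Dim Pth # \<Gamma> \<turnstile> filler (wk B) (wk b) (wk p) (Zero Pth) ?v \<doteq> wk b \<Colon> wk B"
    "R \<tturnstile> Dim Pth # \<Gamma> \<turnstile> filler (wk B) (wk b) (wk p) (One Pth) ?v \<doteq> PApp (wk p) ?v \<Colon> wk B"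
    using filler_zero[OF D wks] filler_one[OF D wks] by simp_all
  have P0: "R \<tturnstile> \<Gamma> \<turnstile> P (Zero Pth) \<doteq> PLam (wk b) \<Colon> Id B (App F (App G (y (Zero Pth)))) b"
    using plam_eq[OF P[of "Zero Pth", unfolded Id_def P_def]] body(1) by (simp add: Id_def P_def)
  have "R \<tturnstile> \<Gamma> \<turnstile> P (One Pth) \<doteq> PLam (PApp (wk p) ?v) \<Colon> Id B (App F (App G (y (One Pth)))) b"
    using plam_eq[OF P[of "One Pth", unfolded Id_def P_def]] body(2) by (simp add: Id_def P_def)
  moreover have pe: "R \<tturnstile> \<Gamma> \<turnstile> PLam (PApp (wk p) ?v) \<doteq> p \<Colon> Id B (App F (App G (y (One Pth)))) b"
    if "R \<tturnstile> \<Gamma> \<turnstile> p \<Colon> Id B (App F (App G (y (One Pth)))) b"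
    using path_eta[OF that[unfolded Id_def]] by (auto intro: eq_sym simp: Id_def)
  have Ga: "R \<tturnstile> \<Gamma> \<turnstile> App G (y (One Pth)) \<doteq> Fst f \<Colon> A"
    using app_cong[OF ctx B G y app_F[OF a] y1] GF[OF a] by (auto intro: eq_trans)
  \<comment> \<open>\<open>p\<close> starts at \<open>F (Fst f)\<close> but is to be compared with
    \<open>P 1\<close>, which starts at \<open>F (G (y 1))\<close>. Substituting \<open>Ga\<close>
    into the family of second components identifies the two path types.\<close>
  have "R \<tturnstile> \<Gamma> \<turnstile> Id B (App F (Fst f)) b \<doteq> Id B (App F (App G (y (One Pth)))) b \<Colon> Typ"
    using eq_inst_Hyp[OF ctx A a app_G[OF y] eq_sym[OF Ga] eq_refl[OF fiber_snd_type[OF ctx A B F b]]]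
    by simp
  then have "R \<tturnstile> \<Gamma> \<turnstile> p \<Colon> Id B (App F (App G (y (One Pth)))) b"
    using p by (rule has_conv[rotated])
  ultimately have P1: "R \<tturnstile> \<Gamma> \<turnstile> P (One Pth) \<doteq> p \<Colon> Id B (App F (App G (y (One Pth)))) b"
    using pe eq_trans by blast
  have fib: "Sigma A (Id (wk B) (App (wk F) (Var 0)) (wk b)) = Fiber A B F b"
    by (simp add: Fiber_def)
  note cong = pair_cong[OF ctx A fiber_snd_type[OF ctx A B F b], unfolded fib, simplified]
  have "R \<tturnstile> \<Gamma> \<turnstile> PLam (wk b) \<Colon> Id B (App F (App G b)) b"
    using has_wk[OF D b] FG[OF b] b by (intro id_plam) (auto intro: eq_sym eq_refl)
  then show "R \<tturnstile> \<Gamma> \<turnstile> contraction b f (Zero Pth) \<doteq> Pair (App G b) (PLam (wk b)) \<Colon> Fiber A B F b"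
    unfolding contr using P0 P y app_cong[OF ctx B G y b y0]
    by (intro cong app_G b) auto
  have "R \<tturnstile> \<Gamma> \<turnstile> contraction b f (One Pth) \<doteq> Pair (Fst f) p \<Colon> Fiber A B F b"
    unfolding contr using P1 P y Ga p a by (intro cong app_G) auto
  moreover have "R \<tturnstile> \<Gamma> \<turnstile> f \<doteq> Pair (Fst f) p \<Colon> Fiber A B F b"
    using sigma_eta[OF f[unfolded Fiber_def]] by (simp add: Fiber_def p_def)
  ultimately show "R \<tturnstile> \<Gamma> \<turnstile> contraction b f (One Pth) \<doteq> f \<Colon> Fiber A B F b"
    by (blast intro: eq_sym eq_trans)
qed

text \<open>The contraction is formed over a fresh path variable by interpreting the locale there; a
  variable point of the fibre and a variable \<open>b\<close> are added later in the same
  way.\<close>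

lemma contraction_path:
  assumes b: "R \<tturnstile> \<Gamma> \<turnstile> b \<Colon> B" and f: "R \<tturnstile> \<Gamma> \<turnstile> f \<Colon> Fiber A B F b"
  shows "\<exists>q. R \<tturnstile> \<Gamma> \<turnstile> q \<Colon> Id (Fiber A B F b) (Pair (App G b) (PLam (wk b))) f"
proof -
  have D: "R \<tturnstile> Ctx (Dim Pth # \<Gamma>)" by (intro ctx_dim ctx)
  interpret D: judgmental_iso R "Dim Pth # \<Gamma>" "wk A" "wk B" "wk F" "wk G" by (rule weaken[OF D])
  have "R \<tturnstile> Dim Pth # \<Gamma> \<turnstile> D.contraction (wk b) (wk f) (Var 0) \<Colon> wk (Fiber A B F b)"
    using D.contraction_has[OF has_wk[OF D b], of "wk f" "Var 0"] has_wk[OF D f] by simp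
  \<comment> \<open>Setting the path variable to an endpoint gives the contraction of the original
    context, so its endpoint equations apply.\<close>
  moreover have "inst (D.contraction (wk b) (wk f) (Var 0)) r = contraction b f r" for r
    by (simp add: contraction_def D.contraction_def inst_PLam)
  ultimately have "R \<tturnstile> \<Gamma> \<turnstile> PLam (D.contraction (wk b) (wk f) (Var 0)) \<Colon>
      Id (Fiber A B F b) (Pair (App G b) (PLam (wk b))) f"
    using contraction_zero[OF b f] contraction_one[OF b f] by (intro id_plam) simp_all
  then show ?thesis ..
qed

lemma fiber_contractible:
  assumes b: "R \<tturnstile> \<Gamma> \<turnstile> b \<Colon> B"
  shows "\<exists>c. R \<tturnstile> \<Gamma> \<turnstile> c \<Colon> IsContr (Fiber A B F b)"
proof -
  have T: "R \<tturnstile> \<Gamma> \<turnstile> Fiber A B F b \<Colon> Typ" by (intro fiber_type ctx A B F b)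
  then have H: "R \<tturnstile> Ctx (Hyp (Fiber A B F b) # \<Gamma>)" by (intro ctx_hyp ctx)
  interpret H: judgmental_iso R "Hyp (Fiber A B F b) # \<Gamma>" "wk A" "wk B" "wk F" "wk G" by (rule weaken[OF H])
  from H.contraction_path[OF has_wk[OF H b], of "Var 0"] var_0[OF H]
  obtain q where "R \<tturnstile> Hyp (Fiber A B F b) # \<Gamma> \<turnstile> q \<Colon>
    Id (wk (Fiber A B F b)) (Pair (App (wk G) (wk b)) (PLam (wk (wk b)))) (Var 0)"
    by auto
  moreover have "Pair (App (wk G) (wk b)) (PLam (wk (wk b))) = wk (Pair (App G b) (PLam (wk b)))"
    by (simp add: ren_conv_sub sub_sub up_ren_def)
  ultimately have "R \<tturnstile> \<Gamma> \<turnstile> Pair (Pair (App G b) (PLam (wk b))) (Lam q) \<Colon> IsContr (Fiber A B F b)"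
    by (intro is_contrI ctx T center_has b) simp
  then show ?thesis ..
qed

lemma equiv: "\<exists>E. R \<tturnstile> \<Gamma> \<turnstile> E \<Colon> Equiv A B"
proof -
  have H: "R \<tturnstile> Ctx (Hyp B # \<Gamma>)" by (intro ctx_hyp ctx B)
  interpret H: judgmental_iso R "Hyp B # \<Gamma>" "wk A" "wk B" "wk F" "wk G" by (rule weaken[OF H])
  from H.fiber_contractible[OF var_0[OF H]] show ?thesis
    by (auto intro: equivI[OF ctx A B F])
qed

end

section \<open>Bridges in dependent pair types\<close>

lemma apart_fresh [simp]: "apart (Var 0) (s # \<Gamma>) = Dead # \<Gamma>"
  by (simp add: apart_def)

lemma apart_const [simp]: "apart (Zero d) \<Gamma> = \<Gamma>" "apart (One d) \<Gamma> = \<Gamma>"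
  by (simp_all add: apart_def)

text \<open>The bridge has to be typed apart from the fresh variable, hence over
  \<open>Dead # \<Gamma>\<close>, and weakening by a dead slot achieves this.\<close>

lemma bridge_app:
  assumes "R \<tturnstile> Ctx \<Gamma>" "R \<tturnstile> \<Gamma> \<turnstile> Q \<Colon> Bridge C X Y"
  shows "R \<tturnstile> Dim Brg # \<Gamma> \<turnstile> BApp (wk Q) (Var 0) \<Colon> C"
  using bapp[OF ctx_dim[OF assms(1)], of Brg "Var 0" "wk Q" "ren (up_ren Suc) C" "wk X" "wk Y"]
    has_wk[OF ctx_dead[OF assms(1)] assms(2)] by (simp add: inst_ren_up_Var)

text \<open>The generic bridge is declared before the bridge dimension. In the opposite order
  \<open>apart\<close> would delete it and the application would not be typable.\<close>

lemma bridge_app_cong: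
  assumes "R \<tturnstile> Ctx \<Gamma>" "R \<tturnstile> \<Gamma> \<turnstile> Bridge C X Y \<Colon> Typ"
    and "R \<tturnstile> \<Gamma> \<turnstile> Q \<Colon> Bridge C X Y" "R \<tturnstile> \<Gamma> \<turnstile> Q' \<Colon> Bridge C X Y" "R \<tturnstile> \<Gamma> \<turnstile> Q \<doteq> Q' \<Colon> Bridge C X Y"
  shows "R \<tturnstile> Dim Brg # \<Gamma> \<turnstile> BApp (wk Q) (Var 0) \<doteq> BApp (wk Q') (Var 0) \<Colon> C"
proof -
  let ?T = "Bridge C X Y" and ?D = "Dim Brg # \<Gamma>"
  have H: "R \<tturnstile> Ctx (Hyp ?T # \<Gamma>)" by (intro ctx_hyp assms)
  have D: "R \<tturnstile> Ctx ?D" by (intro ctx_dim assms)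
  have b: "R \<tturnstile> Dim Brg # Hyp ?T # \<Gamma> \<turnstile> BApp (wk (Var 0)) (Var 0) \<Colon> ren (up_ren Suc) C"
    using bridge_app[OF H, of "Var 0"] var_0[OF H] by simp
  have S: "R \<tturnstile> Sub ?D (up (case_nat P Var)) (Dim Brg # Hyp ?T # \<Gamma>)" if "R \<tturnstile> \<Gamma> \<turnstile> P \<Colon> ?T" for P
    by (intro Sub_up_Dim Sub_inst_Hyp assms that)
  have "R \<tturnstile> SubEq ?D (up (case_nat Q Var)) (up (case_nat Q' Var)) (Dim Brg # Hyp ?T # \<Gamma>)"
  proof (intro subeq_dim subeq_hyp)
    show "R \<tturnstile> SubEq ?D (up (case_nat Q Var) \<circ> Suc \<circ> Suc) (up (case_nat Q' Var) \<circ> Suc \<circ> Suc) \<Gamma>"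
      using SubEq_drop[OF D, of 1] by (simp add: comp_def)
    show "R \<tturnstile> ?D \<turnstile> (up (case_nat Q Var) \<circ> Suc) 0 \<doteq> (up (case_nat Q' Var) \<circ> Suc) 0
        \<Colon> sub (up (case_nat Q Var) \<circ> Suc \<circ> Suc) ?T"
      using eq_wk[OF D assms(5)] by (simp add: comp_def ren_conv_sub up_Var_Suc)
    show "R \<tturnstile> ?D \<turnstile> up (case_nat Q Var) 0 \<doteq> up (case_nat Q' Var) 0 \<Colon> Interval Brg"
      by (auto intro!: eq_refl dim D)
  qed
  from eq_sub[OF S[OF assms(3)] S[OF assms(4)] this eq_refl[OF b]]
  have "R \<tturnstile> ?D \<turnstile> BApp (wk Q) (Var 0) \<doteq> BApp (wk Q') (Var 0) \<Colon> sub (up (case_nat Q Var)) (ren (up_ren Suc) C)"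
    by simp
  moreover have "sub (up (case_nat Q Var)) (ren (up_ren Suc) C) = C"
    by (auto simp: subst_simps intro!: sub_id split: nat.split)
  ultimately show ?thesis by simp
qed

lemma bridge_beta_fresh:
  assumes "R \<tturnstile> Ctx \<Gamma>" "R \<tturnstile> Dim Brg # \<Gamma> \<turnstile> N \<Colon> C"
  shows "R \<tturnstile> Dim Brg # \<Gamma> \<turnstile> BApp (wk (BLam N)) (Var 0) \<doteq> N \<Colon> C"
  using bridge_beta[OF ctx_dim[OF assms(1)], of Brg "Var 0" "ren (up_ren Suc) N" "ren (up_ren Suc) C"]
    has_wk_Dim[OF ctx_dead[OF assms(1)] assms(2)] by (simp add: inst_ren_up_Var)

lemma inst_BLam: "inst (BLam M) r = BLam (sub (up (case_nat r Var)) M)"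
  and inst_Bridge: "inst (Bridge A M N) r = Bridge (sub (up (case_nat r Var)) A) (inst M r) (inst N r)"
  by (simp_all add: inst_def)

text \<open>With \<open>e\<close> an endpoint this computes the ends of the line
  \<open>inst B N\<close>.\<close>

lemma inst_inst: "inst (inst B N) e = inst (sub (up (case_nat e Var)) B) (inst N e)"
  by (auto simp: subst_simps intro!: sub_cong split: nat.split)

text \<open>The bridge-indexed line \<open>x. B[p x/a]\<close>.\<close>

definition dline :: "'c exp \<Rightarrow> 'c exp \<Rightarrow> 'c exp" where
  "dline B p = inst B (BApp (wk p) (Var 0))"

lemma inst_dline: "inst (dline B p) e = inst (sub (up (case_nat e Var)) B) (BApp p e)"
  by (simp add: dline_def inst_inst)

definition fwd1 :: "'c exp \<Rightarrow> 'c exp" where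
  "fwd1 q = BLam (Fst (BApp (wk q) (Var 0)))"

definition fwd2 :: "'c exp \<Rightarrow> 'c exp" where
  "fwd2 q = BLam (Snd (BApp (wk q) (Var 0)))"

definition fwd :: "'c exp \<Rightarrow> 'c exp" where
  "fwd q = Pair (fwd1 q) (fwd2 q)"

definition body :: "'c exp \<Rightarrow> 'c exp" where
  "body w = Pair (BApp (wk (Fst w)) (Var 0)) (BApp (wk (Snd w)) (Var 0))"

definition bwd :: "'c exp \<Rightarrow> 'c exp" where
  "bwd w = BLam (body w)"

definition fwd_map :: "'c exp" where
  "fwd_map = Lam (fwd (Var 0))"

definition bwd_map :: "'c exp" where
  "bwd_map = Lam (bwd (Var 0))"

lemmas map_defs = fwd_map_def bwd_map_def fwd_def fwd1_def fwd2_def bwd_def body_def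

text \<open>Abstractions carry no type annotations, so both maps are closed terms independent of
  \<open>A\<close>, \<open>B\<close> and the ends. The same terms therefore serve in every extended
  context.\<close>

lemma ren_maps [simp]: "ren \<rho> fwd_map = fwd_map" "ren \<rho> bwd_map = bwd_map"
  by (simp_all add: map_defs up_ren_def)

lemma inst_fwd: "inst (fwd (Var 0)) q = fwd q"
  and inst_bwd: "inst (bwd (Var 0)) q = bwd q"
  by (simp_all add: map_defs inst_BLam) 

text \<open>Interpreted over a context with one more variable, this turns results about arbitrary
  elements of the bridge type or of the sum into results about that variable, as needed under a
  \<open>Lam\<close>.\<close>

locale sigma_line =
  fixes R :: "('c jdg set \<times> 'c jdg) set" and \<Gamma> :: "'c ctx" and A B M0 M1 :: "'c exp"
  assumes ctx: "R \<tturnstile> Ctx \<Gamma>"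
    and A: "R \<tturnstile> Dim Brg # \<Gamma> \<turnstile> A \<Colon> Typ"
    and B: "R \<tturnstile> Hyp A # Dim Brg # \<Gamma> \<turnstile> B \<Colon> Typ"
    and M0: "R \<tturnstile> \<Gamma> \<turnstile> M0 \<Colon> inst (Sigma A B) (Zero Brg)"
    and M1: "R \<tturnstile> \<Gamma> \<turnstile> M1 \<Colon> inst (Sigma A B) (One Brg)"
begin

abbreviation "src \<equiv> Bridge (Sigma A B) M0 M1"
abbreviation "base \<equiv> Bridge A (Fst M0) (Fst M1)"
abbreviation "over p \<equiv> Bridge (dline B p) (Snd M0) (Snd M1)"
text \<open>Under the bridge binder the dimension has index 0 and the bridge \<open>p\<close> index
  1. The renaming leaves the two own variables of \<open>B\<close> alone (element and dimension) and
  makes room for \<open>p\<close> behind them.\<close>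

abbreviation "fam \<equiv> Bridge (inst (ren (up_ren (up_ren Suc)) B) (BApp (Var 1) (Var 0)))
          (wk (Snd M0)) (wk (Snd M1))"
abbreviation "tgt \<equiv> Sigma base fam"

text \<open>One name for both ends lets each boundary argument be given once, for
  \<open>e \<in> {Zero Brg, One Brg}\<close>; any other \<open>e\<close> gets the default
  \<open>M1\<close>.\<close>

definition "pt e = (if e = Zero Brg then M0 else M1)"
abbreviation "A_at e \<equiv> inst A e"
abbreviation "B_at e \<equiv> sub (up (case_nat e Var)) B"

lemma pt_simps [simp]: "pt (Zero Brg) = M0" "pt (One Brg) = M1"
  by (simp_all add: pt_def)

lemma inst_fam: "inst fam p = over p"
proof -
  have "sub (up (case_nat p Var)) (inst (ren (up_ren (up_ren Suc)) B) (BApp (Var 1) (Var 0))) = dline B p"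
    by (auto simp: dline_def subst_simps intro!: sub_cong split: nat.split)
  then show ?thesis by (simp add: inst_Bridge del: One_nat_def)
qed

lemma ctx_D: "R \<tturnstile> Ctx (Dim Brg # \<Gamma>)"
  by (intro ctx_dim ctx)

lemma AB: "R \<tturnstile> Dim Brg # \<Gamma> \<turnstile> Sigma A B \<Colon> Typ"
  using A B by (auto intro: sigma)

lemma src_type: "R \<tturnstile> \<Gamma> \<turnstile> src \<Colon> Typ"
  using AB M0 M1 by (auto intro: bridge)

lemma A_at: "e \<in> {Zero Brg, One Brg} \<Longrightarrow> R \<tturnstile> \<Gamma> \<turnstile> A_at e \<Colon> Typ"
  using has_inst_Dim[OF ctx _ A] by simp

lemma B_at:
  assumes "e \<in> {Zero Brg, One Brg}"
  shows "R \<tturnstile> Hyp (A_at e) # \<Gamma> \<turnstile> B_at e \<Colon> Typ"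
  using has_sub[OF Sub_up_Hyp[OF ctx Sub_inst_Dim[OF ctx] A] B, of e] assms by (simp add: inst_def)

lemma AB_at: "e \<in> {Zero Brg, One Brg} \<Longrightarrow> R \<tturnstile> \<Gamma> \<turnstile> Sigma (A_at e) (B_at e) \<Colon> Typ"
  using A_at B_at by (blast intro: sigma)

lemma pt: "e \<in> {Zero Brg, One Brg} \<Longrightarrow> R \<tturnstile> \<Gamma> \<turnstile> pt e \<Colon> Sigma (A_at e) (B_at e)"
  using M0 M1 by (auto simp: inst_Sigma)

lemma fst_pt: "e \<in> {Zero Brg, One Brg} \<Longrightarrow> R \<tturnstile> \<Gamma> \<turnstile> Fst (pt e) \<Colon> A_at e"
  using pt by (blast intro: fst)

lemma snd_pt: "e \<in> {Zero Brg, One Brg} \<Longrightarrow> R \<tturnstile> \<Gamma> \<turnstile> Snd (pt e) \<Colon> inst (B_at e) (Fst (pt e))"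
  using pt by (blast intro: snd)

lemma base_type: "R \<tturnstile> \<Gamma> \<turnstile> base \<Colon> Typ"
  using A fst_pt[of "Zero Brg"] fst_pt[of "One Brg"] by (auto intro: bridge)

text \<open>Second components are moved along equations of first components by this lemma and, at
  the ends, by \<open>B_at_cong\<close>.\<close>

lemma B_cong:
  assumes "R \<tturnstile> Dim Brg # \<Gamma> \<turnstile> N \<Colon> A" "R \<tturnstile> Dim Brg # \<Gamma> \<turnstile> N' \<Colon> A" "R \<tturnstile> Dim Brg # \<Gamma> \<turnstile> N \<doteq> N' \<Colon> A"
  shows "R \<tturnstile> Dim Brg # \<Gamma> \<turnstile> inst B N \<doteq> inst B N' \<Colon> Typ"
  using eq_inst_Hyp[OF ctx_D A assms eq_refl[OF B]] by simp

lemma B_at_cong: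
  assumes "e \<in> {Zero Brg, One Brg}"
    and "R \<tturnstile> \<Gamma> \<turnstile> N \<Colon> A_at e" "R \<tturnstile> \<Gamma> \<turnstile> N' \<Colon> A_at e" "R \<tturnstile> \<Gamma> \<turnstile> N \<doteq> N' \<Colon> A_at e"
  shows "R \<tturnstile> \<Gamma> \<turnstile> inst (B_at e) N \<doteq> inst (B_at e) N' \<Colon> Typ"
  using eq_inst_Hyp[OF ctx A_at[OF assms(1)] assms(2-4) eq_refl[OF B_at[OF assms(1)]]] by simp

lemma bapp_at:
  assumes "e \<in> {Zero Brg, One Brg}" "R \<tturnstile> \<Gamma> \<turnstile> Q \<Colon> Bridge C X Y"
  shows "R \<tturnstile> \<Gamma> \<turnstile> BApp Q e \<Colon> inst C e"
  using bapp[OF ctx, of e Q C X Y] assms by auto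

lemma base_at:
  assumes "e \<in> {Zero Brg, One Brg}" "R \<tturnstile> \<Gamma> \<turnstile> p \<Colon> base"
  shows "R \<tturnstile> \<Gamma> \<turnstile> BApp p e \<doteq> Fst (pt e) \<Colon> A_at e"
  using assms by (auto intro: bridge_zero bridge_one)

lemma dline_type:
  assumes "R \<tturnstile> \<Gamma> \<turnstile> p \<Colon> base"
  shows "R \<tturnstile> Dim Brg # \<Gamma> \<turnstile> dline B p \<Colon> Typ"
  using has_inst_Hyp[OF ctx_D A bridge_app[OF ctx assms] B] by (simp add: dline_def)

text \<open>The line ends in \<open>B\<close> at \<open>p e\<close>, whereas
  \<open>Snd (pt e)\<close> lives in \<open>B\<close> at \<open>Fst (pt e)\<close>; the endpoint
  rule for \<open>p\<close> identifies the two. Without it \<open>over p\<close> would not be a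
  type.\<close>

lemma snd_pt_dline:
  assumes "e \<in> {Zero Brg, One Brg}" "R \<tturnstile> \<Gamma> \<turnstile> p \<Colon> base"
  shows "R \<tturnstile> \<Gamma> \<turnstile> Snd (pt e) \<Colon> inst (dline B p) e"
  unfolding inst_dline
  using has_conv[OF snd_pt[OF assms(1)]]
    B_at_cong[OF assms(1) fst_pt[OF assms(1)] bapp_at[OF assms] eq_sym[OF base_at[OF assms]]] .

lemma over_type:
  assumes "R \<tturnstile> \<Gamma> \<turnstile> p \<Colon> base"
  shows "R \<tturnstile> \<Gamma> \<turnstile> over p \<Colon> Typ"
  using dline_type[OF assms] snd_pt_dline[OF _ assms, of "Zero Brg"] snd_pt_dline[OF _ assms, of "One Brg"]
  by (auto intro: bridge)

lemma weaken:
  assumes "R \<tturnstile> Ctx (s # \<Gamma>)"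
  shows "sigma_line R (s # \<Gamma>) (ren (up_ren Suc) A) (ren (up_ren (up_ren Suc)) B) (wk M0) (wk M1)"
proof
  have S: "R \<tturnstile> Sub (Dim Brg # s # \<Gamma>) (up (\<lambda>i. Var (Suc i))) (Dim Brg # \<Gamma>)"
    by (rule Sub_wk_up_Dim[OF assms])
  show "R \<tturnstile> Ctx (s # \<Gamma>)" by (rule assms)
  show "R \<tturnstile> Dim Brg # s # \<Gamma> \<turnstile> ren (up_ren Suc) A \<Colon> Typ"
    using has_wk_Dim[OF assms A] by simp
  show "R \<tturnstile> Hyp (ren (up_ren Suc) A) # Dim Brg # s # \<Gamma> \<turnstile> ren (up_ren (up_ren Suc)) B \<Colon> Typ"
    using has_sub[OF Sub_up_Hyp[OF ctx_dim[OF assms] S A] B]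
    by (simp add: ren_conv_sub up_Var_Suc)
  have *: "wk (inst (Sigma A B) (c Brg)) = inst (Sigma (ren (up_ren Suc) A) (ren (up_ren (up_ren Suc)) B)) (c Brg)"
    if "c \<in> {Zero, One}" for c
    using that by (auto simp: subst_simps intro!: sub_cong split: nat.split)
  show "R \<tturnstile> s # \<Gamma> \<turnstile> wk M0 \<Colon> inst (Sigma (ren (up_ren Suc) A) (ren (up_ren (up_ren Suc)) B)) (Zero Brg)"
    using has_wk[OF assms M0] *[of Zero] by simp
  show "R \<tturnstile> s # \<Gamma> \<turnstile> wk M1 \<Colon> inst (Sigma (ren (up_ren Suc) A) (ren (up_ren (up_ren Suc)) B)) (One Brg)"
    using has_wk[OF assms M1] *[of One] by simp
qed

text \<open>\<open>fam\<close> is \<open>over\<close> at the generic bridge, so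
  \<open>over_type\<close> of the extended context applies.\<close>

lemma fam_type: "R \<tturnstile> Hyp base # \<Gamma> \<turnstile> fam \<Colon> Typ"
proof -
  have H: "R \<tturnstile> Ctx (Hyp base # \<Gamma>)" by (intro ctx_hyp ctx base_type)
  interpret H: sigma_line R "Hyp base # \<Gamma>" "ren (up_ren Suc) A" "ren (up_ren (up_ren Suc)) B" "wk M0" "wk M1"
    by (rule weaken[OF H])
  show ?thesis
    using H.over_type[of "Var 0"] var_0[OF H] by (simp add: dline_def)
qed

lemma tgt_type: "R \<tturnstile> \<Gamma> \<turnstile> tgt \<Colon> Typ"
  using base_type fam_type by (blast intro: sigma)

section \<open>Typing of the two maps\<close>

lemma src_at:
  assumes "e \<in> {Zero Brg, One Brg}" "R \<tturnstile> \<Gamma> \<turnstile> q \<Colon> src"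
  shows "R \<tturnstile> \<Gamma> \<turnstile> BApp q e \<doteq> pt e \<Colon> Sigma (A_at e) (B_at e)"
    and "R \<tturnstile> \<Gamma> \<turnstile> BApp q e \<Colon> Sigma (A_at e) (B_at e)"
  using assms bapp_at[OF assms] bridge_zero[OF assms(2)] bridge_one[OF assms(2)] by (auto simp: inst_Sigma)

lemma fwd1:
  assumes q: "R \<tturnstile> \<Gamma> \<turnstile> q \<Colon> src"
  shows "R \<tturnstile> \<Gamma> \<turnstile> fwd1 q \<Colon> base"
proof -
  have "R \<tturnstile> \<Gamma> \<turnstile> Fst (BApp q e) \<doteq> Fst (pt e) \<Colon> A_at e" if e: "e \<in> {Zero Brg, One Brg}" for e
    using fst_cong[OF ctx AB_at[OF e] src_at(2)[OF e q] pt[OF e] src_at(1)[OF e q]] .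
  from this[of "Zero Brg"] this[of "One Brg"] show ?thesis
    unfolding fwd1_def using fst[OF bridge_app[OF ctx q]] by (intro blam) simp_all
qed

lemma fwd1_beta:
  assumes q: "R \<tturnstile> \<Gamma> \<turnstile> q \<Colon> src"
  shows "R \<tturnstile> Dim Brg # \<Gamma> \<turnstile> BApp (wk (fwd1 q)) (Var 0) \<doteq> Fst (BApp (wk q) (Var 0)) \<Colon> A"
  unfolding fwd1_def by (intro bridge_beta_fresh ctx fst[OF bridge_app[OF ctx q]])

lemma dline_fwd1:
  assumes q: "R \<tturnstile> \<Gamma> \<turnstile> q \<Colon> src"
  shows "R \<tturnstile> Dim Brg # \<Gamma> \<turnstile> inst B (Fst (BApp (wk q) (Var 0))) \<doteq> dline B (fwd1 q) \<Colon> Typ"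
  unfolding dline_def
  using B_cong[OF fst[OF bridge_app[OF ctx q]] bridge_app[OF ctx fwd1[OF q]] eq_sym[OF fwd1_beta[OF q]]] .

lemma snd_app:
  assumes q: "R \<tturnstile> \<Gamma> \<turnstile> q \<Colon> src"
  shows "R \<tturnstile> Dim Brg # \<Gamma> \<turnstile> Snd (BApp (wk q) (Var 0)) \<Colon> dline B (fwd1 q)"
  using has_conv[OF snd[OF bridge_app[OF ctx q]] dline_fwd1[OF q]] .

lemma fwd2:
  assumes q: "R \<tturnstile> \<Gamma> \<turnstile> q \<Colon> src"
  shows "R \<tturnstile> \<Gamma> \<turnstile> fwd2 q \<Colon> over (fwd1 q)"
proof -
  have "R \<tturnstile> \<Gamma> \<turnstile> Snd (BApp q e) \<doteq> Snd (pt e) \<Colon> inst (dline B (fwd1 q)) e"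
    if e: "e \<in> {Zero Brg, One Brg}" for e
  proof (rule eq_conv)
    show "R \<tturnstile> \<Gamma> \<turnstile> Snd (BApp q e) \<doteq> Snd (pt e) \<Colon> inst (B_at e) (Fst (BApp q e))"
      using snd_cong[OF ctx AB_at[OF e] src_at(2)[OF e q] pt[OF e] src_at(1)[OF e q]] .
    \<comment> \<open>The equality of lines \<open>dline_fwd1\<close>, restricted to the end
      \<open>e\<close>, is the required conversion.\<close>
    show "R \<tturnstile> \<Gamma> \<turnstile> inst (B_at e) (Fst (BApp q e)) \<doteq> inst (dline B (fwd1 q)) e \<Colon> Typ"
      using eq_inst_Dim[OF ctx _ dline_fwd1[OF q], of e] e by (simp add: inst_inst)
  qed
  from this[of "Zero Brg"] this[of "One Brg"] show ?thesis
    unfolding fwd2_def using snd_app[OF q] by (intro blam) simp_all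
qed

lemma fwd:
  assumes q: "R \<tturnstile> \<Gamma> \<turnstile> q \<Colon> src"
  shows "R \<tturnstile> \<Gamma> \<turnstile> fwd q \<Colon> tgt"
  unfolding fwd_def using fwd2[OF q] by (intro pair fam_type fwd1 q) (simp only: inst_fam)

lemma tgt_fst: "R \<tturnstile> \<Gamma> \<turnstile> w \<Colon> tgt \<Longrightarrow> R \<tturnstile> \<Gamma> \<turnstile> Fst w \<Colon> base"
  by (rule fst)

lemma tgt_snd: "R \<tturnstile> \<Gamma> \<turnstile> w \<Colon> tgt \<Longrightarrow> R \<tturnstile> \<Gamma> \<turnstile> Snd w \<Colon> over (Fst w)"
  using snd[of R \<Gamma> w base fam] by (simp only: inst_fam)

lemma snd_app_dline:
  "R \<tturnstile> \<Gamma> \<turnstile> w \<Colon> tgt \<Longrightarrow>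
    R \<tturnstile> Dim Brg # \<Gamma> \<turnstile> BApp (wk (Snd w)) (Var 0) \<Colon> inst B (BApp (wk (Fst w)) (Var 0))"
  using bridge_app[OF ctx tgt_snd] by (simp add: dline_def)

lemma body:
  assumes w: "R \<tturnstile> \<Gamma> \<turnstile> w \<Colon> tgt"
  shows "R \<tturnstile> Dim Brg # \<Gamma> \<turnstile> body w \<Colon> Sigma A B"
  unfolding body_def
  using bridge_app[OF ctx tgt_fst[OF w]] snd_app_dline[OF w] by (intro pair B)

lemma bwd:
  assumes w: "R \<tturnstile> \<Gamma> \<turnstile> w \<Colon> tgt"
  shows "R \<tturnstile> \<Gamma> \<turnstile> bwd w \<Colon> src"
proof -
  have "R \<tturnstile> \<Gamma> \<turnstile> Pair (BApp (Fst w) e) (BApp (Snd w) e) \<doteq> pt e \<Colon> Sigma (A_at e) (B_at e)"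
    if e: "e \<in> {Zero Brg, One Brg}" for e
  \<comment> \<open>The term in the middle is the eta-expansion of \<open>pt e\<close>; its
    components are the ends of \<open>Fst w\<close> and \<open>Snd w\<close>.\<close>
  proof (rule eq_trans)
    have "R \<tturnstile> \<Gamma> \<turnstile> BApp (Snd w) e \<doteq> Snd (pt e) \<Colon> inst (dline B (Fst w)) e"
      using e tgt_snd[OF w] by (auto intro: bridge_zero bridge_one)
    moreover have "R \<tturnstile> \<Gamma> \<turnstile> BApp (Snd w) e \<Colon> inst (dline B (Fst w)) e"
      by (rule bapp_at[OF e tgt_snd[OF w]])
    ultimately show "R \<tturnstile> \<Gamma> \<turnstile> Pair (BApp (Fst w) e) (BApp (Snd w) e) \<doteq> Pair (Fst (pt e)) (Snd (pt e))
        \<Colon> Sigma (A_at e) (B_at e)"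
      unfolding inst_dline
      by (intro pair_cong ctx A_at B_at e fst_pt snd_pt base_at bapp_at[OF e tgt_fst] tgt_fst w)
    show "R \<tturnstile> \<Gamma> \<turnstile> Pair (Fst (pt e)) (Snd (pt e)) \<doteq> pt e \<Colon> Sigma (A_at e) (B_at e)"
      by (rule eq_sym[OF sigma_eta[OF pt[OF e]]])
  qed
  from this[of "Zero Brg"] this[of "One Brg"] show ?thesis
    unfolding bwd_def using body[OF w] by (intro blam) (simp_all add: body_def inst_Sigma)
qed

section \<open>The two round trips\<close>

lemma bwd_fwd:
  assumes q: "R \<tturnstile> \<Gamma> \<turnstile> q \<Colon> src"
  shows "R \<tturnstile> \<Gamma> \<turnstile> bwd (fwd q) \<doteq> q \<Colon> src"
proof -
  define w where "w = fwd q"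
  let ?D = "Dim Brg # \<Gamma>" and ?x = "Var 0"
  have w: "R \<tturnstile> \<Gamma> \<turnstile> w \<Colon> tgt" unfolding w_def by (rule fwd[OF q])
  have o1: "R \<tturnstile> \<Gamma> \<turnstile> fwd2 q \<Colon> inst fam (fwd1 q)" using fwd2[OF q] by (simp only: inst_fam)
  have f1: "R \<tturnstile> \<Gamma> \<turnstile> Fst w \<doteq> fwd1 q \<Colon> base"
    unfolding w_def fwd_def by (rule sigma_beta_fst[OF fam_type fwd1[OF q] o1])
  have f2: "R \<tturnstile> \<Gamma> \<turnstile> Snd w \<doteq> fwd2 q \<Colon> over (fwd1 q)"
    using sigma_beta_snd[OF fam_type fwd1[OF q] o1] unfolding w_def fwd_def by (simp only: inst_fam)
  \<comment> \<open>\<open>Snd w\<close> comes with type \<open>over (Fst w)\<close>, but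
    \<open>f2\<close> lives in \<open>over (fwd1 q)\<close>; substituting \<open>f1\<close> into
    \<open>fam\<close> reconciles them.\<close>
  have "R \<tturnstile> \<Gamma> \<turnstile> over (Fst w) \<doteq> over (fwd1 q) \<Colon> Typ"
    using eq_inst_Hyp[OF ctx base_type tgt_fst[OF w] fwd1[OF q] f1 eq_refl[OF fam_type]]
    by (simp only: inst_fam inst_Typ)
  then have s: "R \<tturnstile> \<Gamma> \<turnstile> Snd w \<Colon> over (fwd1 q)"
    using tgt_snd[OF w] by (rule has_conv[rotated])
  have a: "R \<tturnstile> ?D \<turnstile> BApp (wk (Fst w)) ?x \<doteq> BApp (wk (fwd1 q)) ?x \<Colon> A"
    by (rule bridge_app_cong[OF ctx base_type tgt_fst[OF w] fwd1[OF q] f1])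
  then have 1: "R \<tturnstile> ?D \<turnstile> BApp (wk (Fst w)) ?x \<doteq> Fst (BApp (wk q) ?x) \<Colon> A"
    using fwd1_beta[OF q] by (rule eq_trans)
  have "R \<tturnstile> ?D \<turnstile> BApp (wk (fwd2 q)) ?x \<doteq> Snd (BApp (wk q) ?x) \<Colon> dline B (fwd1 q)"
    unfolding fwd2_def by (rule bridge_beta_fresh[OF ctx snd_app[OF q]])
  with bridge_app_cong[OF ctx over_type[OF fwd1[OF q]] s fwd2[OF q] f2]
  have "R \<tturnstile> ?D \<turnstile> BApp (wk (Snd w)) ?x \<doteq> Snd (BApp (wk q) ?x) \<Colon> dline B (fwd1 q)"
    by (rule eq_trans)
  \<comment> \<open>\<open>pair_cong\<close> wants the second equation in the type determined by the
    left-hand first component, here that of \<open>body w\<close>.\<close>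
  moreover have "R \<tturnstile> ?D \<turnstile> dline B (fwd1 q) \<doteq> inst B (BApp (wk (Fst w)) ?x) \<Colon> Typ"
    unfolding dline_def
    by (rule B_cong[OF bridge_app[OF ctx fwd1[OF q]] bridge_app[OF ctx tgt_fst[OF w]] eq_sym[OF a]])
  ultimately have 2: "R \<tturnstile> ?D \<turnstile> BApp (wk (Snd w)) ?x \<doteq> Snd (BApp (wk q) ?x) \<Colon> inst B (BApp (wk (Fst w)) ?x)"
    by (rule eq_conv)
  have "R \<tturnstile> ?D \<turnstile> body w \<doteq> Pair (Fst (BApp (wk q) ?x)) (Snd (BApp (wk q) ?x)) \<Colon> Sigma A B"
    unfolding body_def
    by (intro pair_cong ctx_D A B bridge_app[OF ctx tgt_fst[OF w]] fst[OF bridge_app[OF ctx q]]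
        snd_app_dline w snd[OF bridge_app[OF ctx q]] 1 2)
  then have "R \<tturnstile> ?D \<turnstile> body w \<doteq> BApp (wk q) ?x \<Colon> Sigma A B"
    using eq_sym[OF sigma_eta[OF bridge_app[OF ctx q]]] by (rule eq_trans)
  then have "R \<tturnstile> \<Gamma> \<turnstile> bwd w \<doteq> BLam (BApp (wk q) ?x) \<Colon> src"
    using bwd[OF w] unfolding bwd_def by (rule blam_eq[rotated])
  then show ?thesis
    using eq_sym[OF bridge_eta[OF q]] unfolding w_def by (rule eq_trans)
qed

lemma fwd_bwd:
  assumes w: "R \<tturnstile> \<Gamma> \<turnstile> w \<Colon> tgt"
  shows "R \<tturnstile> \<Gamma> \<turnstile> fwd (bwd w) \<doteq> w \<Colon> tgt"
proof -
  define q where "q = bwd w"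
  let ?D = "Dim Brg # \<Gamma>" and ?x = "Var 0"
  let ?qx = "BApp (wk q) ?x" and ?a = "BApp (wk (Fst w)) ?x" and ?b = "BApp (wk (Snd w)) ?x"
  have q: "R \<tturnstile> \<Gamma> \<turnstile> q \<Colon> src" unfolding q_def by (rule bwd[OF w])
  have qx: "R \<tturnstile> ?D \<turnstile> ?qx \<doteq> body w \<Colon> Sigma A B"
    unfolding q_def bwd_def by (rule bridge_beta_fresh[OF ctx body[OF w]])
  have a: "R \<tturnstile> ?D \<turnstile> ?a \<Colon> A" by (rule bridge_app[OF ctx tgt_fst[OF w]])
  have b: "R \<tturnstile> ?D \<turnstile> ?b \<Colon> inst B ?a" by (rule snd_app_dline[OF w])
  note qx' = ctx_D AB bridge_app[OF ctx q] body[OF w] qx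
  have fb: "R \<tturnstile> ?D \<turnstile> Fst (body w) \<doteq> ?a \<Colon> A"
    unfolding body_def by (rule sigma_beta_fst[OF B a b])
  have 1: "R \<tturnstile> ?D \<turnstile> Fst ?qx \<doteq> ?a \<Colon> A"
    using fst_cong[OF qx'] fb by (rule eq_trans)
  \<comment> \<open>\<open>?b\<close> is typed over \<open>?a\<close> and \<open>Snd ?qx\<close>
    over \<open>Fst ?qx\<close>. Both are moved to the line of \<open>fwd1 q\<close>, where
    \<open>blam_eq\<close> for \<open>fwd2 q\<close> needs their equation.\<close>
  have conv: "R \<tturnstile> ?D \<turnstile> inst B ?a \<doteq> dline B (fwd1 q) \<Colon> Typ"
    using B_cong[OF a fst[OF bridge_app[OF ctx q]] eq_sym[OF 1]] dline_fwd1[OF q] by (rule eq_trans)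
  have "R \<tturnstile> ?D \<turnstile> Snd ?qx \<doteq> Snd (body w) \<Colon> dline B (fwd1 q)"
    using snd_cong[OF qx'] dline_fwd1[OF q] by (rule eq_conv)
  moreover have "R \<tturnstile> ?D \<turnstile> Snd (body w) \<doteq> ?b \<Colon> dline B (fwd1 q)"
    unfolding body_def using sigma_beta_snd[OF B a b] conv by (rule eq_conv)
  ultimately have 2: "R \<tturnstile> ?D \<turnstile> Snd ?qx \<doteq> ?b \<Colon> dline B (fwd1 q)"
    by (rule eq_trans)
  have "R \<tturnstile> \<Gamma> \<turnstile> fwd1 q \<doteq> BLam ?a \<Colon> base"
    using blam_eq[OF fwd1[OF q, unfolded fwd1_def] 1] by (simp only: fwd1_def)
  then have f1: "R \<tturnstile> \<Gamma> \<turnstile> fwd1 q \<doteq> Fst w \<Colon> base"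
    using eq_sym[OF bridge_eta[OF tgt_fst[OF w]]] by (rule eq_trans)
  have o: "R \<tturnstile> \<Gamma> \<turnstile> over (Fst w) \<doteq> over (fwd1 q) \<Colon> Typ"
    using eq_inst_Hyp[OF ctx base_type tgt_fst[OF w] fwd1[OF q] eq_sym[OF f1] eq_refl[OF fam_type]]
    by (simp only: inst_fam inst_Typ)
  have "R \<tturnstile> \<Gamma> \<turnstile> fwd2 q \<doteq> BLam ?b \<Colon> over (fwd1 q)"
    using blam_eq[OF _ 2] fwd2[OF q] by (simp only: fwd2_def)
  moreover have "R \<tturnstile> \<Gamma> \<turnstile> BLam ?b \<doteq> Snd w \<Colon> over (fwd1 q)"
    using eq_sym[OF bridge_eta[OF tgt_snd[OF w]]] o by (rule eq_conv)
  ultimately have f2: "R \<tturnstile> \<Gamma> \<turnstile> fwd2 q \<doteq> Snd w \<Colon> inst fam (fwd1 q)"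
    unfolding inst_fam by (rule eq_trans)
  have "R \<tturnstile> \<Gamma> \<turnstile> fwd q \<doteq> Pair (Fst w) (Snd w) \<Colon> tgt"
    unfolding fwd_def
    using pair_cong[OF ctx base_type fam_type fwd1[OF q] tgt_fst[OF w] _ snd[OF w] f1 f2] fwd2[OF q]
    by (simp only: inst_fam)
  then show ?thesis
    using eq_sym[OF sigma_eta[OF w]] unfolding q_def by (rule eq_trans)
qed

section \<open>From operations on terms to functions\<close>

lemma wk_src: "wk src = Bridge (Sigma (ren (up_ren Suc) A) (ren (up_ren (up_ren Suc)) B)) (wk M0) (wk M1)"
  by simp

text \<open>Weakening commutes with forming the target, so what the locale yields over a longer
  context is literally a statement about \<open>wk tgt\<close>.\<close>

lemma wk_tgt: "wk tgt = Sigma (Bridge (ren (up_ren Suc) A) (Fst (wk M0)) (Fst (wk M1)))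
    (Bridge (inst (ren (up_ren (up_ren Suc)) (ren (up_ren (up_ren Suc)) B)) (BApp (Var 1) (Var 0)))
      (wk (Snd (wk M0))) (wk (Snd (wk M1))))"
  by (auto simp: subst_simps intro!: sub_cong split: nat.split)

lemma fwd_var: "R \<tturnstile> Hyp src # \<Gamma> \<turnstile> fwd (Var 0) \<Colon> wk tgt"
proof -
  have H: "R \<tturnstile> Ctx (Hyp src # \<Gamma>)" by (intro ctx_hyp ctx src_type)
  interpret H: sigma_line R "Hyp src # \<Gamma>" "ren (up_ren Suc) A" "ren (up_ren (up_ren Suc)) B" "wk M0" "wk M1"
    by (rule weaken[OF H])
  show ?thesis
    unfolding wk_tgt by (rule H.fwd[OF var_0[OF H, unfolded wk_src]])
qed

lemma fwd_map: "R \<tturnstile> \<Gamma> \<turnstile> fwd_map \<Colon> Arr src tgt"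
  unfolding fwd_map_def Arr_def by (rule lam[OF fwd_var])

lemma bwd_var: "R \<tturnstile> Hyp tgt # \<Gamma> \<turnstile> bwd (Var 0) \<Colon> wk src"
proof -
  have H: "R \<tturnstile> Ctx (Hyp tgt # \<Gamma>)" by (intro ctx_hyp ctx tgt_type)
  interpret H: sigma_line R "Hyp tgt # \<Gamma>" "ren (up_ren Suc) A" "ren (up_ren (up_ren Suc)) B" "wk M0" "wk M1"
    by (rule weaken[OF H])
  show ?thesis
    unfolding wk_src by (rule H.bwd[OF var_0[OF H, unfolded wk_tgt]])
qed

lemma bwd_map: "R \<tturnstile> \<Gamma> \<turnstile> bwd_map \<Colon> Arr tgt src"
  unfolding bwd_map_def Arr_def by (rule lam[OF bwd_var])

lemma fwd_map_app: "R \<tturnstile> \<Gamma> \<turnstile> q \<Colon> src \<Longrightarrow> R \<tturnstile> \<Gamma> \<turnstile> App fwd_map q \<doteq> fwd q \<Colon> tgt"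
  using pi_beta[OF fwd_var] unfolding fwd_map_def inst_fwd inst_wk .

lemma bwd_map_app: "R \<tturnstile> \<Gamma> \<turnstile> w \<Colon> tgt \<Longrightarrow> R \<tturnstile> \<Gamma> \<turnstile> App bwd_map w \<doteq> bwd w \<Colon> src"
  using pi_beta[OF bwd_var] unfolding bwd_map_def inst_bwd inst_wk .

lemma bwd_map_fwd_map:
  assumes q: "R \<tturnstile> \<Gamma> \<turnstile> q \<Colon> src"
  shows "R \<tturnstile> \<Gamma> \<turnstile> App bwd_map (App fwd_map q) \<doteq> q \<Colon> src"
proof (rule eq_trans)
  show "R \<tturnstile> \<Gamma> \<turnstile> App bwd_map (App fwd_map q) \<doteq> App bwd_map (fwd q) \<Colon> src"
    by (rule app_cong[OF ctx tgt_type bwd_map app_Arr[OF fwd_map q] fwd[OF q] fwd_map_app[OF q]])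
  show "R \<tturnstile> \<Gamma> \<turnstile> App bwd_map (fwd q) \<doteq> q \<Colon> src"
    using bwd_map_app[OF fwd[OF q]] bwd_fwd[OF q] by (rule eq_trans)
qed

lemma fwd_map_bwd_map:
  assumes w: "R \<tturnstile> \<Gamma> \<turnstile> w \<Colon> tgt"
  shows "R \<tturnstile> \<Gamma> \<turnstile> App fwd_map (App bwd_map w) \<doteq> w \<Colon> tgt"
proof (rule eq_trans)
  show "R \<tturnstile> \<Gamma> \<turnstile> App fwd_map (App bwd_map w) \<doteq> App fwd_map (bwd w) \<Colon> tgt"
    by (rule app_cong[OF ctx src_type fwd_map app_Arr[OF bwd_map w] bwd[OF w] bwd_map_app[OF w]])
  show "R \<tturnstile> \<Gamma> \<turnstile> App fwd_map (bwd w) \<doteq> w \<Colon> tgt"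
    using fwd_map_app[OF bwd[OF w]] fwd_bwd[OF w] by (rule eq_trans)
qed

text \<open>The inverse laws for a generic variable are the round trips of the locale over the
  context extended by that variable, where the closed maps are unchanged.\<close>

lemma judgmental_iso: "judgmental_iso R \<Gamma> src tgt fwd_map bwd_map"
proof
  have H: "R \<tturnstile> Ctx (Hyp src # \<Gamma>)" by (intro ctx_hyp ctx src_type)
  interpret H: sigma_line R "Hyp src # \<Gamma>" "ren (up_ren Suc) A" "ren (up_ren (up_ren Suc)) B" "wk M0" "wk M1"
    by (rule weaken[OF H])
  show "R \<tturnstile> Hyp src # \<Gamma> \<turnstile> App (wk bwd_map) (App (wk fwd_map) (Var 0)) \<doteq> Var 0 \<Colon> wk src"
    unfolding ren_maps wk_src by (rule H.bwd_map_fwd_map[OF var_0[OF H, unfolded wk_src]])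
next
  have H: "R \<tturnstile> Ctx (Hyp tgt # \<Gamma>)" by (intro ctx_hyp ctx tgt_type)
  interpret H: sigma_line R "Hyp tgt # \<Gamma>" "ren (up_ren Suc) A" "ren (up_ren (up_ren Suc)) B" "wk M0" "wk M1"
    by (rule weaken[OF H])
  show "R \<tturnstile> Hyp tgt # \<Gamma> \<turnstile> App (wk fwd_map) (App (wk bwd_map) (Var 0)) \<doteq> Var 0 \<Colon> wk tgt"
    unfolding ren_maps wk_tgt by (rule H.fwd_map_bwd_map[OF var_0[OF H, unfolded wk_tgt]])
qed (intro ctx src_type tgt_type fwd_map bwd_map)+

end

theorem theorem6p1:
  fixes R :: "('c jdg set \<times> 'c jdg) set"
    and \<Gamma> :: "'c ctx" and A B M0 M1 :: "'c exp"
  assumes "R \<tturnstile> Ctx \<Gamma>"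
    and "R \<tturnstile> Dim Brg # \<Gamma> \<turnstile> A \<Colon> Typ"
    and "R \<tturnstile> Hyp A # Dim Brg # \<Gamma> \<turnstile> B \<Colon> Typ"
    and "R \<tturnstile> \<Gamma> \<turnstile> M0 \<Colon> inst (Sigma A B) (Zero Brg)"
    and "R \<tturnstile> \<Gamma> \<turnstile> M1 \<Colon> inst (Sigma A B) (One Brg)"
  shows "\<exists>E. R \<tturnstile> \<Gamma> \<turnstile> E \<Colon>
    Equiv (Bridge (Sigma A B) M0 M1)
      (Sigma (Bridge A (Fst M0) (Fst M1))
        (Bridge (inst (ren (up_ren (up_ren Suc)) B) (BApp (Var 1) (Var 0)))
          (wk (Snd M0)) (wk (Snd M1))))"
proof -
  interpret sigma_line R \<Gamma> A B M0 M1
    using assms by unfold_locales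
  show ?thesis
    using judgmental_iso by (rule judgmental_iso.equiv)
qed

end
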